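(* Suppose that $u_1 : M_1 \to N$ and $u_2: M_2 \to N$ are two smooth maps with equivalent signatures, with corresponding quasiperiodic factorizations $u_1 = U \circ \phi_1$ and $u_2 = U \circ \phi_2$, where $\phi_1: M_1 \to C$, $\phi_2: M_2 \to C$ and $U: C \to N$ (same phase space $C$ and same map $U$). Then the coslice categories $(U \circ \phi_1 \downarrow \mathbf{QuasiP}(u_1))$ and $(U \circ \phi_2 \downarrow \mathbf{QuasiP}(u_2))$ are isomorphic (not merely equivalent).
   Context: Manifolds are smooth manifolds. A quasiperiodic factorization of a smooth map $u: M \to N$ is a factorization $u = U \circ \phi$, where $\phi: M \to C$ is a smooth surjective submersion onto a manifold $C$ (the phase space) and $U: C \to N$ is smooth; it is written $(\phi, U)$ or $U \circ \phi$. The category $\mathbf{QuasiP}(u)$ has the quasiperiodic factorizations of $u$ as objects; a morphism $(\phi_1,U_1) \to (\phi_2,U_2)$, with phase spaces $C_1, C_2$, is a smooth map $c: C_1 \to C_2$ such that $\phi_2 = c \circ \phi_1$ and $U_1 = U_2 \circ c$; composition of morphisms is composition of the maps $c$. Maps $u_1: M_1 \to N$, $u_2: M_2 \to N$ have equivalent signatures if there are quasiperiodic factorizations $u_1 = U \circ \phi_1$ and $u_2 = U \circ \phi_2$ with a common phase space $C$ and a common map $U: C \to N$. For an object $A$ of a category $\mathbf{C}$, the coslice category $(A \downarrow \mathbf{C})$ has as objects the objects $B$ of $\mathbf{C}$ together with a morphism $A \to B$, and as morphisms from $A \to B$ to $A \to B'$ the morphisms $B \to B'$ of $\mathbf{C}$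 making the triangle under $A$ commute. *)

theory Defs
  imports "HOL-Analysis.Analysis"
begin

section \<open>Smooth functions between open subsets of Euclidean spaces\<close>

text \<open>
  The dimension of a phase space varies inside one category, so Euclidean \<open>n\<close>-space is
  the library's \<^const>\<open>Euclidean_space\<close>: sequences vanishing from index \<open>n\<close> on, with
  the product topology.  Below, \<open>S\<close> is meant to be open in \<open>Euclidean_space n\<close>.
\<close>

definition partial_deriv :: "nat \<Rightarrow> ((nat \<Rightarrow> real) \<Rightarrow> real) \<Rightarrow> (nat \<Rightarrow> real) \<Rightarrow> real" where
  "partial_deriv i f a = deriv (\<lambda>t. f (a(i := t))) (a i)"

primrec Ck_on :: "nat \<Rightarrow> nat \<Rightarrow> (nat \<Rightarrow> real) set \<Rightarrow> ((nat \<Rightarrow> real) \<Rightarrow> real) \<Rightarrow> bool" where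
  "Ck_on 0 n S f \<longleftrightarrow> continuous_map (subtopology (Euclidean_space n) S) euclideanreal f"
| "Ck_on (Suc k) n S f \<longleftrightarrow>
     continuous_map (subtopology (Euclidean_space n) S) euclideanreal f \<and>
     (\<forall>i<n. (\<forall>a\<in>S. (\<lambda>t. f (a(i := t))) differentiable at (a i)) \<and>
            Ck_on k n S (partial_deriv i f))"

definition smooth_on ::
    "nat \<Rightarrow> nat \<Rightarrow> (nat \<Rightarrow> real) set \<Rightarrow> ((nat \<Rightarrow> real) \<Rightarrow> nat \<Rightarrow> real) \<Rightarrow> bool" where
  "smooth_on n m S f \<longleftrightarrow> (\<forall>j<m. \<forall>k. Ck_on k n S (\<lambda>a. f a j))"

text \<open>The differential at \<open>a\<close>, as a map from \<open>Euclidean_space n\<close> to \<open>Euclidean_space m\<close>:\<close>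

definition differential ::
    "nat \<Rightarrow> nat \<Rightarrow> ((nat \<Rightarrow> real) \<Rightarrow> nat \<Rightarrow> real) \<Rightarrow> (nat \<Rightarrow> real) \<Rightarrow> (nat \<Rightarrow> real) \<Rightarrow> nat \<Rightarrow> real"
  where
  "differential n m f a v =
     (\<lambda>j. if j < m then \<Sum>i<n. partial_deriv i (\<lambda>b. f b j) a * v i else 0)"


section \<open>Smooth manifolds\<close>

type_synonym 'a chart = "'a set \<times> ('a \<Rightarrow> nat \<Rightarrow> real)"

record 'a manifold =
  mtop :: "'a topology"
  mdim :: nat
  atlas :: "'a chart set"

text \<open>
  Coordinate maps, and maps between manifolds, are \<^const>\<open>extensional\<close>: they take the value
  \<^const>\<open>undefined\<close> off their domain, so that equality in HOL is equality of maps.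
\<close>

definition is_chart :: "'a topology \<Rightarrow> nat \<Rightarrow> 'a chart \<Rightarrow> bool" where
  "is_chart X n = (\<lambda>(U, x). openin X U \<and> x \<in> extensional U \<and>
     openin (Euclidean_space n) (x ` U) \<and>
     homeomorphic_map (subtopology X U) (subtopology (Euclidean_space n) (x ` U)) x)"

definition compatible :: "nat \<Rightarrow> 'a chart \<Rightarrow> 'a chart \<Rightarrow> bool" where
  "compatible n = (\<lambda>(U, x) (V, y).
     smooth_on n n (x ` (U \<inter> V)) (y \<circ> inv_into U x) \<and>
     smooth_on n n (y ` (U \<inter> V)) (x \<circ> inv_into V y))"

text \<open>Second countable Hausdorff space of pure dimension with a maximal smooth atlas:\<close>

definition smooth_manifold :: "'a manifold \<Rightarrow> bool" where
  "smooth_manifold M \<longleftrightarrow>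
     Hausdorff_space (mtop M) \<and> second_countable (mtop M) \<and>
     (\<forall>c\<in>atlas M. is_chart (mtop M) (mdim M) c) \<and>
     (\<forall>p\<in>topspace (mtop M). \<exists>(U, x)\<in>atlas M. p \<in> U) \<and>
     (\<forall>c\<in>atlas M. \<forall>d\<in>atlas M. compatible (mdim M) c d) \<and>
     (\<forall>c. is_chart (mtop M) (mdim M) c \<and> (\<forall>d\<in>atlas M. compatible (mdim M) c d)
          \<longrightarrow> c \<in> atlas M)"

abbreviation carrier :: "'a manifold \<Rightarrow> 'a set" where
  "carrier M \<equiv> topspace (mtop M)"

definition chart_rep ::
    "'a chart \<Rightarrow> 'b chart \<Rightarrow> ('a \<Rightarrow> 'b) \<Rightarrow> (nat \<Rightarrow> real) \<Rightarrow> nat \<Rightarrow> real" where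
  "chart_rep = (\<lambda>(U, x) (V, y) f. y \<circ> f \<circ> inv_into U x)"

definition smooth_map :: "'a manifold \<Rightarrow> 'b manifold \<Rightarrow> ('a \<Rightarrow> 'b) \<Rightarrow> bool" where
  "smooth_map M N f \<longleftrightarrow> f \<in> carrier M \<rightarrow>\<^sub>E carrier N \<and>
     (\<forall>p\<in>carrier M. \<exists>(U, x)\<in>atlas M. \<exists>(V, y)\<in>atlas N.
        p \<in> U \<and> f ` U \<subseteq> V \<and>
        smooth_on (mdim M) (mdim N) (x ` U) (chart_rep (U, x) (V, y) f))"

text \<open>
  A submersion has surjective differential at every point; the differential is
  written in (arbitrary) charts around \<open>p\<close> and \<open>f p\<close>.
\<close>

definition submersion :: "'a manifold \<Rightarrow> 'b manifold \<Rightarrow> ('a \<Rightarrow> 'b) \<Rightarrow> bool" where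
  "submersion M N f \<longleftrightarrow> smooth_map M N f \<and>
     (\<forall>p\<in>carrier M. \<forall>(U, x)\<in>atlas M. \<forall>(V, y)\<in>atlas N. p \<in> U \<longrightarrow> f p \<in> V \<longrightarrow>
        differential (mdim M) (mdim N) (chart_rep (U, x) (V, y) f) (x p)
          ` topspace (Euclidean_space (mdim M)) = topspace (Euclidean_space (mdim N)))"


section \<open>Categories\<close>

record ('o, 'a) category =
  obs :: "'o set"
  arrs :: "'a set"
  src :: "'a \<Rightarrow> 'o"
  tgt :: "'a \<Rightarrow> 'o"
  ident :: "'o \<Rightarrow> 'a"
  cmp :: "'a \<Rightarrow> 'a \<Rightarrow> 'a"  \<comment> \<open>\<open>cmp g f\<close> is \<open>g\<close> after \<open>f\<close>, used only if \<open>tgt f = src g\<close>\<close>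

definition is_category :: "('o, 'a) category \<Rightarrow> bool" where
  "is_category \<C> \<longleftrightarrow>
     (\<forall>f\<in>arrs \<C>. src \<C> f \<in> obs \<C> \<and> tgt \<C> f \<in> obs \<C>) \<and>
     (\<forall>A\<in>obs \<C>. ident \<C> A \<in> arrs \<C> \<and> src \<C> (ident \<C> A) = A \<and> tgt \<C> (ident \<C> A) = A) \<and>
     (\<forall>f\<in>arrs \<C>. \<forall>g\<in>arrs \<C>. tgt \<C> f = src \<C> g \<longrightarrow>
        cmp \<C> g f \<in> arrs \<C> \<and> src \<C> (cmp \<C> g f) = src \<C> f \<and> tgt \<C> (cmp \<C> g f) = tgt \<C> g) \<and>
     (\<forall>f\<in>arrs \<C>. cmp \<C> f (ident \<C> (src \<C> f)) = f \<and> cmp \<C> (ident \<C> (tgt \<C> f)) f = f) \<and>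
     (\<forall>f\<in>arrs \<C>. \<forall>g\<in>arrs \<C>. \<forall>h\<in>arrs \<C>. tgt \<C> f = src \<C> g \<longrightarrow> tgt \<C> g = src \<C> h \<longrightarrow>
        cmp \<C> h (cmp \<C> g f) = cmp \<C> (cmp \<C> h g) f)"

definition is_functor ::
    "('o, 'a) category \<Rightarrow> ('p, 'b) category \<Rightarrow> ('o \<Rightarrow> 'p) \<Rightarrow> ('a \<Rightarrow> 'b) \<Rightarrow> bool" where
  "is_functor \<C> \<D> Fo Fa \<longleftrightarrow> is_category \<C> \<and> is_category \<D> \<and>
     (\<forall>A\<in>obs \<C>. Fo A \<in> obs \<D> \<and> Fa (ident \<C> A) = ident \<D> (Fo A)) \<and>
     (\<forall>f\<in>arrs \<C>. Fa f \<in> arrs \<D> \<and> src \<D> (Fa f) = Fo (src \<C> f) \<and> tgt \<D> (Fa f) = Fo (tgt \<C> f)) \<and>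
     (\<forall>f\<in>arrs \<C>. \<forall>g\<in>arrs \<C>. tgt \<C> f = src \<C> g \<longrightarrow> Fa (cmp \<C> g f) = cmp \<D> (Fa g) (Fa f))"

definition isomorphic_categories :: "('o, 'a) category \<Rightarrow> ('p, 'b) category \<Rightarrow> bool" where
  "isomorphic_categories \<C> \<D> \<longleftrightarrow> (\<exists>Fo Fa Go Ga.
     is_functor \<C> \<D> Fo Fa \<and> is_functor \<D> \<C> Go Ga \<and>
     (\<forall>A\<in>obs \<C>. Go (Fo A) = A) \<and> (\<forall>f\<in>arrs \<C>. Ga (Fa f) = f) \<and>
     (\<forall>B\<in>obs \<D>. Fo (Go B) = B) \<and> (\<forall>g\<in>arrs \<D>. Fa (Ga g) = g))"

text \<open>
  Objects are pairs \<open>(B, f)\<close> with \<open>f\<close> an arrow from \<open>A\<close> to \<open>B\<close>; an arrow carries its source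
  and target, since the same \<open>h\<close> underlies arrows between different objects.
\<close>

definition coslice ::
    "'o \<Rightarrow> ('o, 'a) category \<Rightarrow> ('o \<times> 'a, ('o \<times> 'a) \<times> 'a \<times> ('o \<times> 'a)) category" where
  "coslice A \<C> =
     (let Obs = {(B, f). B \<in> obs \<C> \<and> f \<in> arrs \<C> \<and> src \<C> f = A \<and> tgt \<C> f = B} in
     \<lparr> obs = Obs,
       arrs = {((B, f), h, (B', f')) | B f h B' f'.
                 (B, f) \<in> Obs \<and> (B', f') \<in> Obs \<and>
                 h \<in> arrs \<C> \<and> src \<C> h = B \<and> tgt \<C> h = B' \<and> cmp \<C> h f = f'},
       src = (\<lambda>(X, h, Y). X),
       tgt = (\<lambda>(X, h, Y). Y),
       ident = (\<lambda>X. (X, ident \<C> (fst X), X)),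
       cmp = (\<lambda>(Y', k, Z) (X, h, Y). (X, cmp \<C> k h, Z)) \<rparr>)"


section \<open>Quasiperiodic factorizations\<close>

text \<open>
  A factorization with phase space \<open>C\<close> is a triple \<open>(C, \<phi>, U)\<close>.  All phase spaces have their
  points in one (arbitrary) type \<open>'c\<close>, which plays the role of the universe.
\<close>

type_synonym ('m, 'c, 'n) factorization = "'c manifold \<times> ('m \<Rightarrow> 'c) \<times> ('c \<Rightarrow> 'n)"

definition quasiperiodic_factorization ::
    "'m manifold \<Rightarrow> 'n manifold \<Rightarrow> ('m \<Rightarrow> 'n) \<Rightarrow> ('m, 'c, 'n) factorization \<Rightarrow> bool" where
  "quasiperiodic_factorization M N u = (\<lambda>(C, \<phi>, U).
     smooth_manifold C \<and> submersion M C \<phi> \<and> \<phi> ` carrier M = carrier C \<and>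
     smooth_map C N U \<and> u = compose (carrier M) U \<phi>)"

definition QuasiP ::
    "'m manifold \<Rightarrow> 'n manifold \<Rightarrow> ('m \<Rightarrow> 'n) \<Rightarrow>
     (('m, 'c, 'n) factorization,
      ('m, 'c, 'n) factorization \<times> ('c \<Rightarrow> 'c) \<times> ('m, 'c, 'n) factorization) category" where
  "QuasiP M N u =
     \<lparr> obs = {F. quasiperiodic_factorization M N u F},
       arrs = {((C1, \<phi>1, U1), c, (C2, \<phi>2, U2)) | C1 \<phi>1 U1 c C2 \<phi>2 U2.
                 quasiperiodic_factorization M N u (C1, \<phi>1, U1) \<and>
                 quasiperiodic_factorization M N u (C2, \<phi>2, U2) \<and>
                 smooth_map C1 C2 c \<and>
                 \<phi>2 = compose (carrier M) c \<phi>1 \<and>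
                 U1 = compose (carrier C1) U2 c},
       src = (\<lambda>(X, c, Y). X),
       tgt = (\<lambda>(X, c, Y). Y),
       ident = (\<lambda>X. (X, (\<lambda>p\<in>carrier (fst X). p), X)),
       cmp = (\<lambda>(Y', d, Z) (X, c, Y). (X, compose (carrier (fst X)) d c, Z)) \<rparr>"

end

theory Submission
  imports Defs
begin

text \<open>
  The coslice category under \<open>U \<circ> \<phi>\<close> does not depend on \<open>\<phi>\<close>: it is isomorphic to the category of
  quasiperiodic factorizations of \<open>U\<close>.  An object under \<open>U \<circ> \<phi>\<close> is given by a smooth map \<open>c\<close> out
  of \<open>C\<close> such that \<open>U = U' \<circ> c\<close> and \<open>c \<circ> \<phi>\<close> is a surjective submersion.  As \<open>\<phi>\<close> is itself a
  surjective submersion, the chain rule shows that the latter holds if and only if \<open>c\<close> is a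
  surjective submersion, that is, if and only if \<open>U = U' \<circ> c\<close> is a quasiperiodic factorization.
\<close>

section \<open>The chain rule in \<^const>\<open>Euclidean_space\<close>\<close>

text \<open>Phase spaces of one category have different dimensions, so Euclidean
  \<open>n\<close>-space sits inside a single sequence space, where it is not an open subset. Hence
  no total derivative on open sets is used: everything rests on one-variable derivatives along
  coordinate lines, and the chain rule is drawn from continuity of the partial derivatives by the
  mean value theorem, one coordinate at a time. That the result is an isomorphism and not only an
  equivalence rests on strict recoverability: for an arrow \<open>c\<close> out of
  \<open>U \<circ> \<phi>\<close>, the projection onto the target phase space is forced to be
  \<open>c \<circ> \<phi>\<close>, so it can be forgotten and rebuilt without any change. Going back
  from \<open>c \<circ> \<phi>\<close> to \<open>c\<close> uses surjectivity of
  \<open>\<phi>\<close>: the differential of \<open>c\<close> is controlled only at points that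
  \<open>\<phi>\<close> reaches.\<close>

lemma Euclidean_space_eq_top_of_set:
  "Euclidean_space n = top_of_set (topspace (Euclidean_space n))"
  by (simp add: Euclidean_space_def euclidean_product_topology)

lemma subtopology_Euclidean_space:
  assumes "S \<subseteq> topspace (Euclidean_space n)"
  shows "subtopology (Euclidean_space n) S = top_of_set S"
  using assms
  by (subst Euclidean_space_eq_top_of_set) (simp add: subtopology_subtopology Int_absorb1)

lemma openin_Euclidean_space_iff:
  "openin (Euclidean_space n) S \<longleftrightarrow> (\<exists>T. open T \<and> S = topspace (Euclidean_space n) \<inter> T)"
  by (subst Euclidean_space_eq_top_of_set) (auto simp: openin_open)

text \<open>A basic neighbourhood in the product topology is a product of open sets. The first
  \<open>n\<close> of them contain intervals of a common radius, and from index \<open>n\<close> on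
  both points have coordinate zero.\<close>

lemma openin_Euclidean_space_contains_box:
  assumes "openin (Euclidean_space n) S" and "a \<in> S"
  obtains e where "e > 0"
    and "\<And>b. b \<in> topspace (Euclidean_space n) \<Longrightarrow> (\<And>j. j < n \<Longrightarrow> \<bar>b j - a j\<bar> < e) \<Longrightarrow> b \<in> S"
proof -
  obtain T where T: "open T" "S = topspace (Euclidean_space n) \<inter> T"
    using assms(1) by (auto simp: openin_Euclidean_space_iff)
  have "openin (powertop_real UNIV) T" "a \<in> T"
    using T assms(2) by (auto simp: euclidean_product_topology)
  from product_topology_open_contains_basis[OF this]
  obtain X where X: "a \<in> (\<Pi>\<^sub>E i\<in>UNIV. X i)" "\<And>i. open (X i)" "(\<Pi>\<^sub>E i\<in>UNIV. X i) \<subseteq> T"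
    by auto
  have "\<exists>r>0. \<forall>t. \<bar>t - a j\<bar> < r \<longrightarrow> t \<in> X j" for j
    using X(1) X(2)[of j] by (force simp: open_dist dist_real_def PiE_iff)
  then obtain r where r: "\<And>j. r j > 0" "\<And>j t. \<bar>t - a j\<bar> < r j \<Longrightarrow> t \<in> X j"
    by metis
  \<comment> \<open>The \<open>1\<close> keeps the set nonempty when \<open>n = 0\<close>.\<close>
  define e where "e = Min (insert 1 (r ` {..<n}))"
  have "e > 0" unfolding e_def using r(1) by (subst Min_gr_iff) auto
  have e_le: "e \<le> r j" if "j < n" for j
    unfolding e_def using that by (intro Min_le) auto
  show thesis
  proof (rule that[OF \<open>e > 0\<close>])
    fix b assume b: "b \<in> topspace (Euclidean_space n)" "\<And>j. j < n \<Longrightarrow> \<bar>b j - a j\<bar> < e"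
    have "b j \<in> X j" for j
    proof (cases "j < n")
      case True
      then show ?thesis using b(2)[of j] e_le[of j] r(2)[of "b j" j] by linarith
    next
      case False
      then have "b j = a j"
        using b(1) assms(2) T(2) by (simp add: topspace_Euclidean_space)
      then show ?thesis using X(1) by (simp add: PiE_iff)
    qed
    then show "b \<in> S" using X(3) b(1) T(2) by (auto simp: PiE_iff)
  qed
qed

lemma continuous_on_Euclidean_space_box:
  fixes f :: "(nat \<Rightarrow> real) \<Rightarrow> real"
  assumes S: "openin (Euclidean_space n) S" and a: "a \<in> S"
    and f: "continuous_on S f" and "\<epsilon> > 0"
  obtains e where "e > 0"
    and "\<And>b. b \<in> topspace (Euclidean_space n) \<Longrightarrow> (\<And>j. j < n \<Longrightarrow> \<bar>b j - a j\<bar> < e) \<Longrightarrow>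
           b \<in> S \<and> \<bar>f b - f a\<bar> < \<epsilon>"
proof -
  obtain T where T: "open T" "S = topspace (Euclidean_space n) \<inter> T"
    using S by (auto simp: openin_Euclidean_space_iff)
  have "openin (top_of_set S) (S \<inter> f -` ball (f a) \<epsilon>)"
    using f by (intro continuous_openin_preimage_gen) auto
  then obtain T' where "open T'" "S \<inter> f -` ball (f a) \<epsilon> = S \<inter> T'"
    by (auto simp: openin_open)
  then have "openin (Euclidean_space n) (S \<inter> f -` ball (f a) \<epsilon>)"
    unfolding openin_Euclidean_space_iff using T by (intro exI[of _ "T \<inter> T'"]) auto
  moreover have "a \<in> S \<inter> f -` ball (f a) \<epsilon>"
    using a \<open>\<epsilon> > 0\<close> by simp
  ultimately show thesis
  proof (rule openin_Euclidean_space_contains_box)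
    fix e assume "e > 0"
      and "\<And>b. b \<in> topspace (Euclidean_space n) \<Longrightarrow> (\<And>j. j < n \<Longrightarrow> \<bar>b j - a j\<bar> < e) \<Longrightarrow>
             b \<in> S \<inter> f -` ball (f a) \<epsilon>"
    then show thesis
      by (intro that[of e]) (force simp: dist_real_def abs_minus_commute)+
  qed
qed

text \<open>The segment carries no orientation because the moving coordinate may lie on either side
  of its limit.\<close>

lemma mvt_closed_segment:
  fixes g :: "real \<Rightarrow> real"
  assumes "\<And>x. x \<in> closed_segment a b \<Longrightarrow> (g has_real_derivative g' x) (at x)"
  shows "\<exists>\<xi>\<in>closed_segment a b. g b - g a = g' \<xi> * (b - a)"
proof -
  have *: "\<exists>\<xi>\<in>{l..r}. g r - g l = g' \<xi> * (r - l)"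
    if "l \<le> r" "\<And>x. l \<le> x \<Longrightarrow> x \<le> r \<Longrightarrow> (g has_real_derivative g' x) (at x)" for l r
    using mvt_very_simple[of l r g "\<lambda>x. (*) (g' x)"] that
    by (auto simp: has_field_derivative_def intro: has_derivative_at_withinI)
  show ?thesis
  proof (cases "a \<le> b")
    case True
    then show ?thesis using *[of a b] assms by (auto simp: closed_segment_eq_real_ivl)
  next
    case False
    then show ?thesis using *[of b a] assms
      by (simp add: closed_segment_eq_real_ivl algebra_simps) (metis add.commute)
  qed
qed

text \<open>The base point \<open>h t\<close> moves as well, but only continuously; coordinate
  \<open>i\<close> alone moves differentiably. By the mean value theorem the increment is
  \<open>s t - a i\<close> times the partial derivative at a nearby point, and continuity of the
  partial derivative at \<open>a\<close> makes that factor converge.\<close>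

lemma has_real_derivative_coordinate_step:
  assumes S: "openin (Euclidean_space n) S" and a: "a \<in> S" and i: "i < n"
    and diff: "\<And>b. b \<in> S \<Longrightarrow> (\<lambda>t. f (b(i := t))) differentiable at (b i)"
    and cont: "continuous_on S (partial_deriv i f)"
    and h: "\<And>j. j < n \<Longrightarrow> isCont (\<lambda>t. h t j) t0" "\<And>t. h t \<in> topspace (Euclidean_space n)"
      "\<And>t. h t i = a i" "h t0 = a"
    and s: "(s has_real_derivative s') (at t0)" "s t0 = a i"
  shows "((\<lambda>t. f ((h t)(i := s t)) - f (h t)) has_real_derivative partial_deriv i f a * s') (at t0)"
proof -
  \<comment> \<open>A difference quotient with the expected limit filled in where the denominator
    vanishes, so that \<open>D\<close> can be continuous at \<open>t0\<close>.\<close>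
  define D where "D t = (if s t = a i then partial_deriv i f a
    else (f ((h t)(i := s t)) - f (h t)) / (s t - a i))" for t
  have FD: "f ((h t)(i := s t)) - f (h t) = D t * (s t - a i)" for t
    using h(3)[of t] by (cases "s t = a i") (auto simp: D_def fun_upd_idem)
  have Dt0: "D t0 = partial_deriv i f a" using s(2) by (simp add: D_def)
  have "isCont D t0"
    unfolding isCont_def
  proof (rule tendstoI)
    fix \<epsilon> :: real assume "\<epsilon> > 0"
    from continuous_on_Euclidean_space_box[OF S a cont this]
    obtain e where e: "e > 0" "\<And>b. b \<in> topspace (Euclidean_space n) \<Longrightarrow>
        (\<And>j. j < n \<Longrightarrow> \<bar>b j - a j\<bar> < e) \<Longrightarrow>
        b \<in> S \<and> \<bar>partial_deriv i f b - partial_deriv i f a\<bar> < \<epsilon>"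
      by metis
    have "isCont s t0" using s(1) by (rule DERIV_isCont)
    then have "\<forall>\<^sub>F t in at t0. \<bar>s t - a i\<bar> < e"
      using tendstoD[of s _ "at t0" e] \<open>e > 0\<close> s(2) by (auto simp: isCont_def dist_real_def)
    moreover have "\<forall>\<^sub>F t in at t0. \<forall>j\<in>{..<n}. \<bar>h t j - a j\<bar> < e"
    proof (rule eventually_ball_finite, simp, rule ballI)
      fix j assume "j \<in> {..<n}"
      then show "\<forall>\<^sub>F t in at t0. \<bar>h t j - a j\<bar> < e"
        using tendstoD[of "\<lambda>t. h t j" _ "at t0" e] h(1)[of j] h(4) \<open>e > 0\<close>
        by (auto simp: isCont_def dist_real_def)
    qed
    ultimately show "\<forall>\<^sub>F t in at t0. dist (D t) (D t0) < \<epsilon>"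
    proof eventually_elim
      case (elim t)
      show ?case
      proof (cases "s t = a i")
        case True
        then show ?thesis using \<open>\<epsilon> > 0\<close> Dt0 by (simp add: D_def)
      next
        case False
        have box: "(h t)(i := \<xi>) \<in> S \<and>
            \<bar>partial_deriv i f ((h t)(i := \<xi>)) - partial_deriv i f a\<bar> < \<epsilon>"
          if "\<xi> \<in> closed_segment (a i) (s t)" for \<xi>
        proof (rule e(2))
          show "(h t)(i := \<xi>) \<in> topspace (Euclidean_space n)"
            using h(2)[of t] i by (auto simp: topspace_Euclidean_space)
          show "\<bar>((h t)(i := \<xi>)) j - a j\<bar> < e" if "j < n" for j
            using elim that \<open>\<xi> \<in> _\<close> by (auto simp: closed_segment_eq_real_ivl split: if_splits)
        qed
        have "((\<lambda>\<xi>. f ((h t)(i := \<xi>))) has_real_derivative partial_deriv i f ((h t)(i := \<xi>))) (at \<xi>)"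
          if "\<xi> \<in> closed_segment (a i) (s t)" for \<xi>
          using diff[of "(h t)(i := \<xi>)"] box[OF that]
          by (auto simp: partial_deriv_def DERIV_deriv_iff_real_differentiable)
        from mvt_closed_segment[of "a i" "s t" "\<lambda>\<xi>. f ((h t)(i := \<xi>))", OF this]
        obtain \<xi> where \<xi>: "\<xi> \<in> closed_segment (a i) (s t)"
          "f ((h t)(i := s t)) - f ((h t)(i := a i)) = partial_deriv i f ((h t)(i := \<xi>)) * (s t - a i)"
          by auto
        have "(h t)(i := a i) = h t" using h(3)[of t] by (simp add: fun_upd_idem)
        then have "D t = partial_deriv i f ((h t)(i := \<xi>))"
          using \<xi>(2) False by (simp add: D_def)
        then show ?thesis using box[OF \<xi>(1)] Dt0 by (simp add: dist_real_def)
      qed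
    qed
  qed
  \<comment> \<open>Caratheodory's form of the derivative of \<open>s\<close>; the product
    \<open>D t * q t\<close> then plays the same role for the increment of \<open>f\<close>.\<close>
  moreover obtain q where q: "\<And>t. s t - s t0 = q t * (t - t0)" "isCont q t0" "q t0 = s'"
    using s(1) by (auto simp: CARAT_DERIV)
  ultimately show ?thesis
    unfolding CARAT_DERIV
    using FD Dt0 s(2) h(3,4)
    by (intro exI[of _ "\<lambda>t. D t * q t"]) (auto simp: fun_upd_idem simp flip: q(1) intro: isCont_mult)
qed

text \<open>The increment of \<open>f\<close> along the curve is telescoped through points that move one coordinate
  at a time.\<close>

lemma has_real_derivative_along_curve:
  assumes S: "openin (Euclidean_space n) S" and a: "\<gamma> t0 \<in> S"
    and diff: "\<And>b i. b \<in> S \<Longrightarrow> i < n \<Longrightarrow> (\<lambda>t. f (b(i := t))) differentiable at (b i)"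
    and cont: "\<And>i. i < n \<Longrightarrow> continuous_on S (partial_deriv i f)"
    and \<gamma>: "\<forall>\<^sub>F t in nhds t0. \<gamma> t \<in> topspace (Euclidean_space n)"
      "\<And>i. i < n \<Longrightarrow> ((\<lambda>t. \<gamma> t i) has_real_derivative \<gamma>' i) (at t0)"
  shows "((\<lambda>t. f (\<gamma> t)) has_real_derivative (\<Sum>i<n. partial_deriv i f (\<gamma> t0) * \<gamma>' i)) (at t0)"
proof -
  define a where "a = \<gamma> t0"
  define h where "h i t = (\<lambda>j. if j < i then \<gamma> t j else a j)" for i t
  have aE: "a \<in> topspace (Euclidean_space n)"
    using a openin_subset[OF S] by (auto simp: a_def)
  have "((\<lambda>t. f ((h i t)(i := \<gamma> t i)) - f (h i t)) has_real_derivative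
      partial_deriv i f a * \<gamma>' i) (at t0)" if i: "i < n" for i
  proof (rule has_real_derivative_coordinate_step[OF S _ i])
    show "isCont (\<lambda>t. h i t j) t0" if "j < n" for j
      using DERIV_isCont[OF \<gamma>(2)[OF that]] by (cases "j < i") (auto simp: h_def)
    show "h i t \<in> topspace (Euclidean_space n)" for t
      using aE i by (auto simp: h_def topspace_Euclidean_space)
  qed (use a i diff cont \<gamma>(2) in \<open>auto simp: a_def h_def\<close>)
  moreover have "(h i t)(i := \<gamma> t i) = h (Suc i) t" for i t
    by (auto simp: h_def fun_eq_iff)
  ultimately have "((\<lambda>t. f a + (\<Sum>i<n. f (h (Suc i) t) - f (h i t))) has_real_derivative
      0 + (\<Sum>i<n. partial_deriv i f a * \<gamma>' i)) (at t0)"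
    by (intro DERIV_add DERIV_sum DERIV_const) auto
  moreover have "(\<Sum>i<n. f (h (Suc i) t) - f (h i t)) = f (h n t) - f (h 0 t)" for t
    by (rule sum_lessThan_telescope)
  moreover have "h 0 t = a" for t by (simp add: h_def)
  ultimately have "((\<lambda>t. f (h n t)) has_real_derivative (\<Sum>i<n. partial_deriv i f a * \<gamma>' i)) (at t0)"
    by simp
  \<comment> \<open>\<open>h n t\<close> has the zeros of \<open>a\<close> from index
    \<open>n\<close> on, so it equals \<open>\<gamma> t\<close> only while the curve stays in
    Euclidean space, which is given only near \<open>t0\<close>.\<close>
  moreover have "\<forall>\<^sub>F t in nhds t0. f (h n t) = f (\<gamma> t)"
    using \<gamma>(1)
  proof eventually_elim
    case (elim t)
    then have "h n t = \<gamma> t"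
      using aE by (auto simp: h_def topspace_Euclidean_space fun_eq_iff)
    then show ?case by simp
  qed
  ultimately show ?thesis
    unfolding a_def by (simp add: DERIV_cong_ev)
qed


section \<open>Smooth functions\<close>

lemma Ck_on_imp_continuous_map:
  "Ck_on k n S f \<Longrightarrow> continuous_map (subtopology (Euclidean_space n) S) euclideanreal f"
  by (cases k) auto

lemma Ck_on_imp_continuous_on:
  assumes "Ck_on k n S f" and "S \<subseteq> topspace (Euclidean_space n)"
  shows "continuous_on S f"
  using Ck_on_imp_continuous_map[OF assms(1)] subtopology_Euclidean_space[OF assms(2)] by simp

text \<open>Holds for arbitrary subsets because \<open>partial_deriv\<close> differentiates along
  the full coordinate line and not within \<open>S\<close>.\<close>

lemma Ck_on_subset:
  assumes "Ck_on k n S f" and "S' \<subseteq> S"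
  shows "Ck_on k n S' f"
  using assms(1)
proof (induction k arbitrary: f)
  case 0
  then show ?case using assms(2) by (auto intro: continuous_map_from_subtopology_mono)
next
  case (Suc k)
  then show ?case using assms(2) by (auto intro: continuous_map_from_subtopology_mono)
qed

lemma Ck_on_Suc_imp_Ck_on: "Ck_on (Suc k) n S f \<Longrightarrow> Ck_on k n S f"
  by (induction k arbitrary: f) auto

lemma eventually_fun_upd_in_open:
  assumes "openin (Euclidean_space n) S" and "a \<in> S" and "i < n"
  shows "\<forall>\<^sub>F t in nhds (a i). a(i := t) \<in> S"
proof -
  obtain e where e: "e > 0" "\<And>b. b \<in> topspace (Euclidean_space n) \<Longrightarrow>
      (\<And>j. j < n \<Longrightarrow> \<bar>b j - a j\<bar> < e) \<Longrightarrow> b \<in> S"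
    using openin_Euclidean_space_contains_box[OF assms(1,2)] by metis
  have "a \<in> topspace (Euclidean_space n)"
    using assms(1,2) openin_subset by auto
  then have "a(i := t) \<in> S" if "dist t (a i) < e" for t
    using that e(1) \<open>i < n\<close> by (intro e(2)) (auto simp: topspace_Euclidean_space dist_real_def)
  then show ?thesis using e(1) by (auto simp: eventually_nhds_metric)
qed

lemma has_real_derivative_partial_deriv:
  assumes "Ck_on (Suc k) n S f" and "a \<in> S" and "i < n"
  shows "((\<lambda>t. f (a(i := t))) has_real_derivative partial_deriv i f a) (at (a i))"
  using assms by (simp add: partial_deriv_def DERIV_deriv_iff_real_differentiable)

text \<open>A partial derivative at \<open>a\<close> looks at neighbours of \<open>a\<close> on a
  coordinate line; openness of \<open>S\<close> keeps them in the set where the two functions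
  agree.\<close>

lemma Ck_on_cong:
  assumes S: "openin (Euclidean_space n) S" and "\<And>a. a \<in> S \<Longrightarrow> f a = g a" and "Ck_on k n S f"
  shows "Ck_on k n S g"
  using assms(2,3)
proof (induction k arbitrary: f g)
  case 0
  then show ?case by (auto intro: continuous_map_eq)
next
  case (Suc k)
  have ev: "\<forall>\<^sub>F t in nhds (a i). f (a(i := t)) = g (a(i := t))" if "a \<in> S" "i < n" for a i
    using eventually_fun_upd_in_open[OF S that] by eventually_elim (rule Suc.prems(1))
  have "partial_deriv i f a = partial_deriv i g a" if "a \<in> S" "i < n" for a i
    unfolding partial_deriv_def using ev[OF that] by (rule deriv_cong_ev) simp
  then have "Ck_on k n S (partial_deriv i g)" if "i < n" for i
    using Suc.IH[of "partial_deriv i f"] Suc.prems(2) that by auto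
  moreover have "(\<lambda>t. g (a(i := t))) differentiable at (a i)" if "a \<in> S" "i < n" for a i
    using has_real_derivative_partial_deriv[OF Suc.prems(2) that]
      DERIV_cong_ev[OF refl ev[OF that] refl]
    unfolding real_differentiable_def by blast
  ultimately show ?case
    using Suc.prems by (auto intro: continuous_map_eq)
qed

text \<open>Lets a formula \<open>f'\<close>, as supplied by the product and chain rules, stand in
  for the partial derivatives. The two agree on \<open>S\<close> only, which
  \<open>Ck_on_cong\<close> turns into an exchange.\<close>

lemma Ck_on_SucI:
  assumes S: "openin (Euclidean_space n) S"
    and "continuous_on S f"
    and f': "\<And>a i. a \<in> S \<Longrightarrow> i < n \<Longrightarrow> ((\<lambda>t. f (a(i := t))) has_real_derivative f' i a) (at (a i))"
    and "\<And>i. i < n \<Longrightarrow> Ck_on k n S (f' i)"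
  shows "Ck_on (Suc k) n S f"
proof -
  have "Ck_on k n S (partial_deriv i f)" if "i < n" for i
    by (rule Ck_on_cong[OF S _ assms(4)[OF that]])
      (use DERIV_imp_deriv[OF f'[OF _ that]] in \<open>simp add: partial_deriv_def\<close>)
  then show ?thesis
    using assms(2) f' subtopology_Euclidean_space[OF openin_subset[OF S]]
    by (auto simp: real_differentiable_def)
qed

text \<open>Serves to glue the chart-by-chart information in \<open>smooth_map\<close>.
  Differentiability is a condition at single points, and continuity can be tested in a neighbourhood
  of each point.\<close>

lemma Ck_on_local:
  assumes S: "S \<subseteq> topspace (Euclidean_space n)"
    and "\<And>a. a \<in> S \<Longrightarrow> \<exists>S'. openin (Euclidean_space n) S' \<and> a \<in> S' \<and> Ck_on k n S' f"
  shows "Ck_on k n S f"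
  using assms(2)
proof (induction k arbitrary: f)
  case 0
  have "continuous_on S f"
    unfolding continuous_on_eq_continuous_within
  proof
    fix a assume a: "a \<in> S"
    then obtain S' where S': "openin (Euclidean_space n) S'" "a \<in> S'" "Ck_on 0 n S' f"
      using 0 by blast
    then obtain T where T: "open T" "S' = topspace (Euclidean_space n) \<inter> T"
      by (auto simp: openin_Euclidean_space_iff)
    have "continuous_on S' f"
      by (rule Ck_on_imp_continuous_on[OF S'(3) openin_subset[OF S'(1)]])
    then have "continuous_on (S \<inter> S') f" by (rule continuous_on_subset) auto
    then have "continuous (at a within (S \<inter> S')) f"
      using a S'(2) by (auto simp: continuous_on_eq_continuous_within)
    moreover have "at a within S = at a within (S \<inter> S')"
      using T S S'(2) by (intro at_within_nhd[of _ T]) auto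
    ultimately show "continuous (at a within S) f" by simp
  qed
  then show ?case by (simp add: subtopology_Euclidean_space[OF S])
next
  case (Suc k)
  have "Ck_on k n S f"
    using Suc.prems by (intro Suc.IH) (blast dest: Ck_on_Suc_imp_Ck_on)
  moreover have "(\<lambda>t. f (a(i := t))) differentiable at (a i)" if "a \<in> S" "i < n" for a i
    using Suc.prems[OF that(1)] that(2) by auto
  moreover have "Ck_on k n S (partial_deriv i f)" if "i < n" for i
    using Suc.prems that by (intro Suc.IH) (auto, blast)
  ultimately show ?case
    by (auto dest: Ck_on_imp_continuous_map)
qed

lemma Ck_on_zero: "openin (Euclidean_space n) S \<Longrightarrow> Ck_on k n S (\<lambda>_. 0)"
proof (induction k)
  case (Suc k)
  then show ?case by (intro Ck_on_SucI[where f' = "\<lambda>_ _. 0"]) auto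
qed simp

lemma Ck_on_add:
  assumes S: "openin (Euclidean_space n) S" and "Ck_on k n S f" and "Ck_on k n S g"
  shows "Ck_on k n S (\<lambda>a. f a + g a)"
  using assms(2,3)
proof (induction k arbitrary: f g)
  case 0
  then show ?case by (auto intro: continuous_map_add)
next
  case (Suc k)
  show ?case
  proof (rule Ck_on_SucI[OF S, where f' = "\<lambda>i a. partial_deriv i f a + partial_deriv i g a"])
    show "continuous_on S (\<lambda>a. f a + g a)"
      by (intro continuous_on_add Ck_on_imp_continuous_on[OF Suc.prems(1)]
          Ck_on_imp_continuous_on[OF Suc.prems(2)] openin_subset[OF S])
    show "((\<lambda>t. f (a(i := t)) + g (a(i := t))) has_real_derivative
        partial_deriv i f a + partial_deriv i g a) (at (a i))" if "a \<in> S" "i < n" for a i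
      using that Suc.prems by (intro DERIV_add has_real_derivative_partial_deriv)
  qed (use Suc in auto)
qed

lemma Ck_on_mult:
  assumes S: "openin (Euclidean_space n) S" and "Ck_on k n S f" and "Ck_on k n S g"
  shows "Ck_on k n S (\<lambda>a. f a * g a)"
  using assms(2,3)
proof (induction k arbitrary: f g)
  case 0
  then show ?case by (auto intro: continuous_map_real_mult)
next
  case (Suc k)
  show ?case
  proof (rule Ck_on_SucI[OF S,
        where f' = "\<lambda>i a. partial_deriv i f a * g a + partial_deriv i g a * f a"])
    show "continuous_on S (\<lambda>a. f a * g a)"
      by (intro continuous_on_mult Ck_on_imp_continuous_on[OF Suc.prems(1)]
          Ck_on_imp_continuous_on[OF Suc.prems(2)] openin_subset[OF S])
    show "((\<lambda>t. f (a(i := t)) * g (a(i := t))) has_real_derivative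
        partial_deriv i f a * g a + partial_deriv i g a * f a) (at (a i))" if "a \<in> S" "i < n" for a i
      by (rule DERIV_cong[OF DERIV_mult[OF has_real_derivative_partial_deriv[OF Suc.prems(1) that]
              has_real_derivative_partial_deriv[OF Suc.prems(2) that]]]) simp
    show "Ck_on k n S (\<lambda>a. partial_deriv i f a * g a + partial_deriv i g a * f a)" if "i < n" for i
      using Suc.prems[THEN Ck_on_Suc_imp_Ck_on] Suc.prems that
      by (intro Ck_on_add[OF S] Suc.IH) auto
  qed
qed

lemma Ck_on_sum:
  assumes "openin (Euclidean_space n) S" and "\<And>j. j < (m::nat) \<Longrightarrow> Ck_on k n S (f j)"
  shows "Ck_on k n S (\<lambda>a. \<Sum>j<m. f j a)"
  using assms(2) by (induction m) (auto intro: Ck_on_zero Ck_on_add assms(1))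

text \<open>\<open>smooth_on\<close> constrains only the coordinates below \<open>m\<close>; the
  others are constantly zero because the image lies in Euclidean \<open>m\<close>-space.\<close>

lemma smooth_on_imp_continuous_on:
  assumes g: "smooth_on n m S g" and S: "S \<subseteq> topspace (Euclidean_space n)"
    and gS: "g ` S \<subseteq> topspace (Euclidean_space m)"
  shows "continuous_on S g"
proof (rule continuous_on_coordinatewise_then_product)
  fix j
  show "continuous_on S (\<lambda>a. g a j)"
  proof (cases "j < m")
    case True
    then show ?thesis
      using g S Ck_on_imp_continuous_on unfolding smooth_on_def by blast
  next
    case False
    then have "g a j = 0" if "a \<in> S" for a
      using gS that by (auto simp: topspace_Euclidean_space)
    then show ?thesis by (simp cong: continuous_on_cong_simp)
  qed
qed

text \<open>The curve is \<open>g (a(i := t))\<close> as a function of \<open>t\<close>. It is known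
  to lie in Euclidean space only while \<open>a(i := t)\<close> is in \<open>S\<close>, which is why
  the rule for curves asks for this only near the parameter.\<close>

lemma has_real_derivative_compose_partial:
  assumes S: "openin (Euclidean_space n) S" and T: "openin (Euclidean_space m) T"
    and gS: "g ` S \<subseteq> T" and f: "Ck_on (Suc k) m T f"
    and g: "\<And>j. j < m \<Longrightarrow> Ck_on (Suc k) n S (\<lambda>a. g a j)" and a: "a \<in> S" and i: "i < n"
  shows "((\<lambda>t. f (g (a(i := t)))) has_real_derivative
      (\<Sum>j<m. partial_deriv j f (g a) * partial_deriv i (\<lambda>b. g b j) a)) (at (a i))"
proof -
  have "((\<lambda>t. f (g (a(i := t)))) has_real_derivative
      (\<Sum>j<m. partial_deriv j f (g (a(i := a i))) * partial_deriv i (\<lambda>b. g b j) a)) (at (a i))"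
  proof (rule has_real_derivative_along_curve[OF T])
    show "continuous_on T (partial_deriv j f)" if "j < m" for j
      using f that openin_subset[OF T] by (auto intro: Ck_on_imp_continuous_on)
    show "\<forall>\<^sub>F t in nhds (a i). g (a(i := t)) \<in> topspace (Euclidean_space m)"
      using eventually_fun_upd_in_open[OF S a i]
      by eventually_elim (use gS openin_subset[OF T] in auto)
    show "((\<lambda>t. g (a(i := t)) j) has_real_derivative partial_deriv i (\<lambda>b. g b j) a) (at (a i))"
      if "j < m" for j
      using has_real_derivative_partial_deriv[OF g[OF that] a i] .
    show "(\<lambda>t. f (b(j := t))) differentiable at (b j)" if "b \<in> T" "j < m" for b j
      using f that unfolding Ck_on.simps by blast
  qed (use gS a in auto)
  then show ?thesis by simp
qed

text \<open>In the induction only \<open>f\<close> loses an order with each differentiation and has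
  to be generalized; \<open>g\<close> stays fixed and is smooth, so its partial derivatives have
  every order required.\<close>

lemma Ck_on_compose:
  assumes S: "openin (Euclidean_space n) S" and T: "openin (Euclidean_space m) T"
    and gS: "g ` S \<subseteq> T" and "Ck_on k m T f" and g: "smooth_on n m S g"
  shows "Ck_on k n S (\<lambda>a. f (g a))"
  using assms(4)
proof (induction k arbitrary: f)
  case (0 f)
  have "continuous_on S g"
    using smooth_on_imp_continuous_on[OF g openin_subset[OF S]] gS openin_subset[OF T] by blast
  moreover have "continuous_on T f"
    using 0 openin_subset[OF T] by (rule Ck_on_imp_continuous_on)
  ultimately have "continuous_on S (\<lambda>a. f (g a))"
    using continuous_on_compose2 gS by blast
  then show ?case by (simp add: subtopology_Euclidean_space[OF openin_subset[OF S]])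
next
  case (Suc k)
  show ?case
  proof (rule Ck_on_SucI[OF S,
        where f' = "\<lambda>i a. \<Sum>j<m. partial_deriv j f (g a) * partial_deriv i (\<lambda>b. g b j) a"])
    show "continuous_on S (\<lambda>a. f (g a))"
      using Suc.IH[OF Ck_on_Suc_imp_Ck_on[OF Suc.prems]] openin_subset[OF S]
      by (rule Ck_on_imp_continuous_on)
    show "((\<lambda>t. f (g (a(i := t)))) has_real_derivative
        (\<Sum>j<m. partial_deriv j f (g a) * partial_deriv i (\<lambda>b. g b j) a)) (at (a i))"
      if "a \<in> S" "i < n" for a i
      using g by (intro has_real_derivative_compose_partial[OF S T gS Suc.prems _ that])
        (unfold smooth_on_def, blast)
    show "Ck_on k n S (\<lambda>a. \<Sum>j<m. partial_deriv j f (g a) * partial_deriv i (\<lambda>b. g b j) a)"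
      if "i < n" for i
    proof (intro Ck_on_sum Ck_on_mult S)
      fix j assume j: "j < m"
      show "Ck_on k n S (\<lambda>a. partial_deriv j f (g a))"
        using Suc.prems j by (intro Suc.IH) auto
      have "Ck_on (Suc k) n S (\<lambda>b. g b j)" using g j unfolding smooth_on_def by blast
      then show "Ck_on k n S (partial_deriv i (\<lambda>b. g b j))" using \<open>i < n\<close> by simp
    qed
  qed
qed

lemma smooth_on_compose:
  assumes "openin (Euclidean_space n) S" and "openin (Euclidean_space m) T"
    and "g ` S \<subseteq> T" and "smooth_on m l T f" and "smooth_on n m S g"
  shows "smooth_on n l S (f \<circ> g)"
  using Ck_on_compose[OF assms(1-3) _ assms(5)] assms(4) by (auto simp: smooth_on_def)

lemma smooth_on_subset: "smooth_on n m S f \<Longrightarrow> S' \<subseteq> S \<Longrightarrow> smooth_on n m S' f"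
  unfolding smooth_on_def by (blast intro: Ck_on_subset)

lemma smooth_on_cong:
  assumes "openin (Euclidean_space n) S" and "\<And>a. a \<in> S \<Longrightarrow> f a = g a" and "smooth_on n m S f"
  shows "smooth_on n m S g"
  unfolding smooth_on_def
proof (intro allI impI)
  fix j k assume "j < m"
  show "Ck_on k n S (\<lambda>a. g a j)"
    by (rule Ck_on_cong[OF assms(1), where f = "\<lambda>a. f a j"])
      (use \<open>j < m\<close> assms(2,3) in \<open>auto simp: smooth_on_def\<close>)
qed

lemma smooth_on_local:
  assumes "S \<subseteq> topspace (Euclidean_space n)"
    and "\<And>a. a \<in> S \<Longrightarrow> \<exists>S'. openin (Euclidean_space n) S' \<and> a \<in> S' \<and> smooth_on n m S' f"
  shows "smooth_on n m S f"
  unfolding smooth_on_def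
proof (intro allI impI)
  fix j k assume "j < m"
  then show "Ck_on k n S (\<lambda>a. f a j)"
    using assms(2) unfolding smooth_on_def by (intro Ck_on_local[OF assms(1)]) blast
qed

section \<open>The differential and its chain rule\<close>

lemma differential_in_Euclidean_space:
  "differential n m f a v \<in> topspace (Euclidean_space m)"
  by (simp add: differential_def topspace_Euclidean_space)

lemma differential_compose:
  assumes S: "openin (Euclidean_space n) S" and T: "openin (Euclidean_space m) T"
    and gS: "g ` S \<subseteq> T" and f: "smooth_on m l T f" and g: "smooth_on n m S g" and a: "a \<in> S"
  shows "differential n l (f \<circ> g) a v = differential m l f (g a) (differential n m g a v)"
proof
  fix k
  have "partial_deriv i (\<lambda>b. f (g b) k) a =
      (\<Sum>j<m. partial_deriv j (\<lambda>b. f b k) (g a) * partial_deriv i (\<lambda>b. g b j) a)"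
    if "k < l" "i < n" for i
    unfolding partial_deriv_def[of i "\<lambda>b. f (g b) k"]
    using f g that
    by (intro DERIV_imp_deriv has_real_derivative_compose_partial[OF S T gS _ _ a, of 0])
      (unfold smooth_on_def, blast+)
  then have "(\<Sum>i<n. partial_deriv i (\<lambda>b. f (g b) k) a * v i) =
      (\<Sum>j<m. partial_deriv j (\<lambda>b. f b k) (g a) * (\<Sum>i<n. partial_deriv i (\<lambda>b. g b j) a * v i))"
    if "k < l"
    using that
    by (simp add: sum_distrib_left sum_distrib_right mult.assoc) (rule sum.swap)
  then show "differential n l (f \<circ> g) a v k = differential m l f (g a) (differential n m g a v) k"
    by (simp add: differential_def)
qed

lemma differential_cong:
  assumes S: "openin (Euclidean_space n) S" and "a \<in> S" and eq: "\<And>b. b \<in> S \<Longrightarrow> f b = g b"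
  shows "differential n m f a v = differential n m g a v"
proof -
  have "partial_deriv i (\<lambda>b. f b j) a = partial_deriv i (\<lambda>b. g b j) a" if "i < n" for i j
  proof -
    have "\<forall>\<^sub>F t in nhds (a i). f (a(i := t)) j = g (a(i := t)) j"
      using eventually_fun_upd_in_open[OF S \<open>a \<in> S\<close> that]
      by eventually_elim (simp add: eq)
    then show ?thesis
      unfolding partial_deriv_def by (rule deriv_cong_ev) simp
  qed
  then show ?thesis by (auto simp: differential_def fun_eq_iff intro: sum.cong)
qed


section \<open>Smooth maps between manifolds\<close>

lemma atlas_chart:
  assumes "smooth_manifold M" and "(U, x) \<in> atlas M"
  shows "openin (mtop M) U" and "U \<subseteq> carrier M" and "x \<in> extensional U" and "inj_on x U"
    and "openin (Euclidean_space (mdim M)) (x ` U)"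
    and "homeomorphic_map (subtopology (mtop M) U)
           (subtopology (Euclidean_space (mdim M)) (x ` U)) x"
proof -
  have "\<forall>c\<in>atlas M. is_chart (mtop M) (mdim M) c"
    using assms(1) unfolding smooth_manifold_def by (elim conjE)
  then have "is_chart (mtop M) (mdim M) (U, x)"
    using assms(2) by (rule bspec)
  then show "openin (mtop M) U" "x \<in> extensional U"
    "openin (Euclidean_space (mdim M)) (x ` U)"
    and hom: "homeomorphic_map (subtopology (mtop M) U)
           (subtopology (Euclidean_space (mdim M)) (x ` U)) x"
    by (auto simp: is_chart_def)
  then show sub: "U \<subseteq> carrier M" by (auto dest: openin_subset)
  show "inj_on x U"
    using homeomorphic_imp_injective_map[OF hom] sub by (simp add: Int_absorb1)
qed

lemma inv_into_chart:
  assumes "smooth_manifold M" and "(U, x) \<in> atlas M" and "p \<in> U"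
  shows "inv_into U x (x p) = p"
  using atlas_chart(4)[OF assms(1,2)] assms(3) by simp

lemma chart_covers:
  assumes "smooth_manifold M" and "p \<in> carrier M"
  obtains U x where "(U, x) \<in> atlas M" and "p \<in> U"
proof -
  have "\<forall>p\<in>carrier M. \<exists>(U, x)\<in>atlas M. p \<in> U"
    using assms(1) unfolding smooth_manifold_def by (elim conjE)
  then show thesis using assms(2) that by fast
qed

lemma openin_chart_image:
  assumes M: "smooth_manifold M" "(U, x) \<in> atlas M" and "openin (mtop M) V" and "V \<subseteq> U"
  shows "openin (Euclidean_space (mdim M)) (x ` V)"
proof -
  have "open_map (subtopology (mtop M) U) (subtopology (Euclidean_space (mdim M)) (x ` U)) x"
    using atlas_chart(6)[OF M] by (rule homeomorphic_imp_open_map)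
  moreover have "openin (subtopology (mtop M) U) V"
    using assms(3,4) by (metis openin_subtopology_Int2 Int_absorb1)
  ultimately have "openin (subtopology (Euclidean_space (mdim M)) (x ` U)) (x ` V)"
    by (auto simp: open_map_def)
  then show ?thesis
    using atlas_chart(5)[OF M] by (rule openin_trans_full)
qed

lemma smooth_on_transition:
  assumes "smooth_manifold M" and "(U, x) \<in> atlas M" and "(V, y) \<in> atlas M"
  shows "smooth_on (mdim M) (mdim M) (x ` (U \<inter> V)) (y \<circ> inv_into U x)"
proof -
  have "\<forall>c\<in>atlas M. \<forall>d\<in>atlas M. compatible (mdim M) c d"
    using assms(1) unfolding smooth_manifold_def by (elim conjE)
  from bspec[OF bspec[OF this assms(2)] assms(3)] show ?thesis
    by (simp add: compatible_def)
qed

text \<open>Maximality of the atlas is used here: the restricted chart is compatible with all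
  others. Smoothness of a composite needs such charts, since \<open>smooth_map\<close> asks for a
  chart domain that is mapped entirely into one target chart.\<close>

lemma restrict_chart_in_atlas:
  assumes M: "smooth_manifold M" and U: "(U, x) \<in> atlas M"
    and V: "openin (mtop M) V" "V \<subseteq> U"
  shows "(V, restrict x V) \<in> atlas M"
proof -
  note chart = atlas_chart[OF M U]
  have img: "restrict x V ` V' = x ` V'" if "V' \<subseteq> V" for V'
    using that by (auto simp: image_def)
  have "homeomorphic_map (subtopology (subtopology (mtop M) U) V)
      (subtopology (subtopology (Euclidean_space (mdim M)) (x ` U)) (x ` V)) x"
  proof (rule homeomorphic_map_subtopologies[OF chart(6)])
    have "x ` U \<subseteq> topspace (Euclidean_space (mdim M))"
      using chart(5) by (rule openin_subset)
    then show "x ` (topspace (subtopology (mtop M) U) \<inter> V) =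
        topspace (subtopology (Euclidean_space (mdim M)) (x ` U)) \<inter> x ` V"
      using chart(2) V(2) by auto
  qed
  then have "homeomorphic_map (subtopology (mtop M) V)
      (subtopology (Euclidean_space (mdim M)) (x ` V)) x"
    using V(2) by (simp add: subtopology_subtopology Int_absorb1 image_mono)
  then have "homeomorphic_map (subtopology (mtop M) V)
      (subtopology (Euclidean_space (mdim M)) (x ` V)) (restrict x V)"
    by (rule homeomorphic_map_eq) auto
  then have "is_chart (mtop M) (mdim M) (V, restrict x V)"
    using V openin_chart_image[OF M U V] by (simp add: is_chart_def)
  moreover have "compatible (mdim M) (V, restrict x V) (W, y)" if W: "(W, y) \<in> atlas M" for W y
  proof -
    note chart' = atlas_chart[OF M W]
    have op: "openin (mtop M) (V \<inter> W)" using V(1) chart'(1) by blast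
    have "smooth_on (mdim M) (mdim M) (x ` (V \<inter> W)) (y \<circ> inv_into U x)"
      using smooth_on_transition[OF M U W] V(2) by (auto intro: smooth_on_subset)
    then have "smooth_on (mdim M) (mdim M) (x ` (V \<inter> W)) (y \<circ> inv_into V (restrict x V))"
    proof (rule smooth_on_cong[rotated -1])
      show "openin (Euclidean_space (mdim M)) (x ` (V \<inter> W))"
        using openin_chart_image[OF M U op] V(2) by blast
      fix a assume "a \<in> x ` (V \<inter> W)"
      then obtain p where p: "p \<in> V" "a = x p" by blast
      have "inj_on (restrict x V) V" using chart(4) V(2) by (auto simp: inj_on_def)
      then have "inv_into V (restrict x V) (restrict x V p) = p" using p(1) by (rule inv_into_f_f)
      then show "(y \<circ> inv_into U x) a = (y \<circ> inv_into V (restrict x V)) a"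
        using p V(2) inv_into_chart[OF M U] by auto
    qed
    moreover have "smooth_on (mdim M) (mdim M) (y ` (V \<inter> W)) (x \<circ> inv_into W y)"
      using smooth_on_transition[OF M W U] V(2) by (auto intro: smooth_on_subset)
    then have "smooth_on (mdim M) (mdim M) (y ` (V \<inter> W)) (restrict x V \<circ> inv_into W y)"
    proof (rule smooth_on_cong[rotated -1])
      show "openin (Euclidean_space (mdim M)) (y ` (V \<inter> W))"
        using openin_chart_image[OF M W op] by blast
      fix a assume "a \<in> y ` (V \<inter> W)"
      then show "(x \<circ> inv_into W y) a = (restrict x V \<circ> inv_into W y) a"
        using inv_into_chart[OF M W] by auto
    qed
    ultimately show ?thesis
      by (simp add: compatible_def img)
  qed
  then have "\<forall>d\<in>atlas M. compatible (mdim M) (V, restrict x V) d" by fast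
  moreover have "\<forall>c. is_chart (mtop M) (mdim M) c \<and> (\<forall>d\<in>atlas M. compatible (mdim M) c d)
      \<longrightarrow> c \<in> atlas M"
    using M unfolding smooth_manifold_def by (elim conjE)
  ultimately show ?thesis by blast
qed

section \<open>Smooth maps: continuity, independence of charts, composites\<close>

lemma smooth_map_funcset: "smooth_map M N f \<Longrightarrow> p \<in> carrier M \<Longrightarrow> f p \<in> carrier N"
  by (auto simp: smooth_map_def)

lemma smooth_map_charts:
  assumes "smooth_map M N f" and "p \<in> carrier M"
  obtains U x V y where "(U, x) \<in> atlas M" and "(V, y) \<in> atlas N" and "p \<in> U" and "f ` U \<subseteq> V"
    and "smooth_on (mdim M) (mdim N) (x ` U) (y \<circ> f \<circ> inv_into U x)"
  using assms unfolding smooth_map_def chart_rep_def by fast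

text \<open>Continuity is not part of the definition. On a chart domain \<open>f\<close> is the
  continuous coordinate map, then the continuous representative, then the continuous inverse of the
  target coordinates.\<close>

lemma smooth_map_imp_continuous_map:
  assumes M: "smooth_manifold M" and N: "smooth_manifold N" and f: "smooth_map M N f"
  shows "continuous_map (mtop M) (mtop N) f"
  unfolding continuous_map_def
proof (intro conjI allI impI)
  show "f \<in> carrier M \<rightarrow> carrier N" using f by (auto simp: smooth_map_def)
  fix Q assume Q: "openin (mtop N) Q"
  show "openin (mtop M) {p \<in> carrier M. f p \<in> Q}"
  proof (subst openin_subopen, intro ballI)
    fix p assume p: "p \<in> {p \<in> carrier M. f p \<in> Q}"
    then obtain U x V y where U: "(U, x) \<in> atlas M" and V: "(V, y) \<in> atlas N" and
      "p \<in> U" and fU: "f ` U \<subseteq> V"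
      and smooth: "smooth_on (mdim M) (mdim N) (x ` U) (y \<circ> f \<circ> inv_into U x)"
      using smooth_map_charts[OF f] by blast
    let ?r = "y \<circ> f \<circ> inv_into U x"
    note cU = atlas_chart[OF M U] and cV = atlas_chart[OF N V]
    note xU = openin_subset[OF cU(5)] and yV = openin_subset[OF cV(5)]
    have r: "?r ` x ` U \<subseteq> y ` V"
      using fU inv_into_chart[OF M U] by auto
    then have "continuous_on (x ` U) ?r"
      using smooth_on_imp_continuous_on[OF smooth xU] yV by blast
    then have "continuous_map (subtopology (Euclidean_space (mdim M)) (x ` U))
        (subtopology (Euclidean_space (mdim N)) (y ` V)) ?r"
      using r by (auto simp: subtopology_Euclidean_space xU yV)
    moreover obtain g where
      g: "homeomorphic_maps (subtopology (mtop N) V) (subtopology (Euclidean_space (mdim N)) (y ` V)) y g"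
      using cV(6) by (auto simp: homeomorphic_map_maps)
    moreover have "continuous_map (subtopology (mtop M) U)
        (subtopology (Euclidean_space (mdim M)) (x ` U)) x"
      using cU(6) by (rule homeomorphic_imp_continuous_map)
    ultimately have "continuous_map (subtopology (mtop M) U) (subtopology (mtop N) V) (g \<circ> (?r \<circ> x))"
      unfolding homeomorphic_maps_def by (blast intro: continuous_map_compose)
    then have "continuous_map (subtopology (mtop M) U) (subtopology (mtop N) V) f"
    proof (rule continuous_map_eq)
      fix q assume "q \<in> topspace (subtopology (mtop M) U)"
      then have "q \<in> U" by simp
      then have "f q \<in> topspace (subtopology (mtop N) V)"
        using fU cV(2) by auto
      then show "(g \<circ> (?r \<circ> x)) q = f q"
        using g \<open>q \<in> U\<close> inv_into_chart[OF M U] by (simp add: homeomorphic_maps_def)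
    qed
    then have "continuous_map (subtopology (mtop M) U) (mtop N) f"
      by (simp add: continuous_map_in_subtopology)
    then have "openin (subtopology (mtop M) U) {q \<in> topspace (subtopology (mtop M) U). f q \<in> Q}"
      using Q by (rule openin_continuous_map_preimage)
    then have "openin (mtop M) {q \<in> topspace (subtopology (mtop M) U). f q \<in> Q}"
      using cU(1) by (rule openin_trans_full)
    then show "\<exists>T. openin (mtop M) T \<and> p \<in> T \<and> T \<subseteq> {p \<in> carrier M. f p \<in> Q}"
      using p \<open>p \<in> U\<close> cU(2)
      by (intro exI[of _ "{q \<in> topspace (subtopology (mtop M) U). f q \<in> Q}"] conjI) auto
  qed
qed

lemma openin_smooth_map_preimage:
  assumes "smooth_manifold M" and "smooth_manifold N" and "smooth_map M N f"
    and "openin (mtop M) U" and "openin (mtop N) V"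
  shows "openin (mtop M) {p \<in> U. f p \<in> V}"
proof -
  have "openin (mtop M) {p \<in> carrier M. f p \<in> V}"
    using smooth_map_imp_continuous_map[OF assms(1-3)] assms(5)
    by (rule openin_continuous_map_preimage)
  then have "openin (mtop M) (U \<inter> {p \<in> carrier M. f p \<in> V})"
    using assms(4) by blast
  moreover have "U \<inter> {p \<in> carrier M. f p \<in> V} = {p \<in> U. f p \<in> V}"
    using openin_subset[OF assms(4)] by auto
  ultimately show ?thesis by simp
qed

text \<open>The definition of \<^const>\<open>smooth_map\<close> provides one suitable pair of charts around each point;
  smoothness in all charts follows from smoothness of the transition maps.\<close>

lemma smooth_on_chart_rep:
  assumes M: "smooth_manifold M" and N: "smooth_manifold N" and f: "smooth_map M N f"
    and U: "(U, x) \<in> atlas M" and V: "(V, y) \<in> atlas N"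
  shows "smooth_on (mdim M) (mdim N) (x ` {p \<in> U. f p \<in> V}) (chart_rep (U, x) (V, y) f)"
proof (rule smooth_on_local)
  note cU = atlas_chart[OF M U] and cV = atlas_chart[OF N V]
  show "x ` {p \<in> U. f p \<in> V} \<subseteq> topspace (Euclidean_space (mdim M))"
    using openin_subset[OF cU(5)] by blast
  fix a assume "a \<in> x ` {p \<in> U. f p \<in> V}"
  then obtain p where p: "p \<in> U" "f p \<in> V" "a = x p" by blast
  then have "p \<in> carrier M" using cU(2) by blast
  then obtain U' x' V' y' where U': "(U', x') \<in> atlas M" and V': "(V', y') \<in> atlas N" and
    "p \<in> U'" and fU': "f ` U' \<subseteq> V'"
    and smooth: "smooth_on (mdim M) (mdim N) (x' ` U') (y' \<circ> f \<circ> inv_into U' x')"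
    by (rule smooth_map_charts[OF f])
  note cU' = atlas_chart[OF M U'] and cV' = atlas_chart[OF N V']
  \<comment> \<open>The part of \<open>U\<close> where both pairs of charts apply: \<open>f\<close>
    maps it into \<open>V\<close>, and into \<open>V'\<close> because it lies in \<open>U'\<close>.
    There the new representative is the given one placed between two transition maps.\<close>
  define P where "P = {p \<in> U \<inter> U'. f p \<in> V}"
  have P: "openin (mtop M) P"
    unfolding P_def using cU(1) cU'(1) cV(1) by (intro openin_smooth_map_preimage[OF M N f]) auto
  have xP: "openin (Euclidean_space (mdim M)) (x ` P)"
    by (rule openin_chart_image[OF M U P]) (auto simp: P_def)
  have x'P: "openin (Euclidean_space (mdim M)) (x' ` P)"
    by (rule openin_chart_image[OF M U' P]) (auto simp: P_def)
  have yV: "openin (Euclidean_space (mdim N)) (y' ` (V' \<inter> V))"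
    using cV(1) cV'(1) by (intro openin_chart_image[OF N V']) auto
  have "smooth_on (mdim M) (mdim N) (x ` P)
      ((y \<circ> inv_into V' y') \<circ> ((y' \<circ> f \<circ> inv_into U' x') \<circ> (x' \<circ> inv_into U x)))"
  proof (rule smooth_on_compose[OF xP yV])
    show "smooth_on (mdim M) (mdim N) (x ` P) ((y' \<circ> f \<circ> inv_into U' x') \<circ> (x' \<circ> inv_into U x))"
    proof (rule smooth_on_compose[OF xP x'P])
      show "(x' \<circ> inv_into U x) ` x ` P \<subseteq> x' ` P"
        using inv_into_chart[OF M U] by (auto simp: P_def)
      show "smooth_on (mdim M) (mdim N) (x' ` P) (y' \<circ> f \<circ> inv_into U' x')"
        using smooth by (rule smooth_on_subset) (auto simp: P_def)
      show "smooth_on (mdim M) (mdim M) (x ` P) (x' \<circ> inv_into U x)"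
        using smooth_on_transition[OF M U U'] by (rule smooth_on_subset) (auto simp: P_def)
    qed
    show "((y' \<circ> f \<circ> inv_into U' x') \<circ> (x' \<circ> inv_into U x)) ` x ` P \<subseteq> y' ` (V' \<inter> V)"
      using fU' inv_into_chart[OF M U] inv_into_chart[OF M U'] by (auto simp: P_def)
    show "smooth_on (mdim N) (mdim N) (y' ` (V' \<inter> V)) (y \<circ> inv_into V' y')"
      by (rule smooth_on_transition[OF N V' V])
  qed
  then have "smooth_on (mdim M) (mdim N) (x ` P) (chart_rep (U, x) (V, y) f)"
  proof (rule smooth_on_cong[OF xP, rotated -1])
    fix b assume "b \<in> x ` P"
    then obtain q where q: "q \<in> U" "q \<in> U'" "f q \<in> V" "b = x q" by (auto simp: P_def)
    moreover have "f q \<in> V'" using q fU' by auto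
    ultimately show "((y \<circ> inv_into V' y') \<circ> ((y' \<circ> f \<circ> inv_into U' x') \<circ> (x' \<circ> inv_into U x))) b =
        chart_rep (U, x) (V, y) f b"
      using inv_into_chart[OF M U] inv_into_chart[OF M U'] inv_into_chart[OF N V']
      by (simp add: chart_rep_def)
  qed
  then show "\<exists>S'. openin (Euclidean_space (mdim M)) S' \<and> a \<in> S' \<and>
      smooth_on (mdim M) (mdim N) S' (chart_rep (U, x) (V, y) f)"
    using xP p \<open>p \<in> U'\<close> by (intro exI[of _ "x ` P"]) (auto simp: P_def)
qed

text \<open>Representatives compose to the representative of the composite only where each point
  lands in the next chart. \<open>V0\<close> and \<open>U0\<close> are these domains; they are open
  because smooth maps are continuous.\<close>

locale composable_charts =
  fixes M :: "'a manifold" and N :: "'b manifold" and P :: "'c manifold"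
    and f :: "'a \<Rightarrow> 'b" and g :: "'b \<Rightarrow> 'c" and U x V y W z
  assumes M_manifold: "smooth_manifold M" and N_manifold: "smooth_manifold N" and P_manifold: "smooth_manifold P"
    and f_smooth: "smooth_map M N f" and g_smooth: "smooth_map N P g"
    and U_chart: "(U, x) \<in> atlas M" and V_chart: "(V, y) \<in> atlas N" and W_chart: "(W, z) \<in> atlas P"
begin

definition "V0 = {q \<in> V. g q \<in> W}"

definition "U0 = {p \<in> U. f p \<in> V0}"

lemma openin_V0: "openin (mtop N) V0"
  unfolding V0_def using atlas_chart(1)[OF N_manifold V_chart] atlas_chart(1)[OF P_manifold W_chart]
  by (rule openin_smooth_map_preimage[OF N_manifold P_manifold g_smooth])

lemma openin_U0: "openin (mtop M) U0"
  unfolding U0_def using atlas_chart(1)[OF M_manifold U_chart] openin_V0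
  by (rule openin_smooth_map_preimage[OF M_manifold N_manifold f_smooth])

lemma openin_image_V0: "openin (Euclidean_space (mdim N)) (y ` V0)"
  by (rule openin_chart_image[OF N_manifold V_chart openin_V0]) (auto simp: V0_def)

lemma openin_image_U0: "openin (Euclidean_space (mdim M)) (x ` U0)"
  by (rule openin_chart_image[OF M_manifold U_chart openin_U0]) (auto simp: U0_def)

lemma chart_rep_image: "chart_rep (U, x) (V, y) f ` x ` U0 \<subseteq> y ` V0"
  using inv_into_chart[OF M_manifold U_chart] by (auto simp: chart_rep_def U0_def)

lemma smooth_on_f: "smooth_on (mdim M) (mdim N) (x ` U0) (chart_rep (U, x) (V, y) f)"
  using smooth_on_chart_rep[OF M_manifold N_manifold f_smooth U_chart V_chart]
  by (rule smooth_on_subset) (auto simp: U0_def V0_def)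

lemma smooth_on_g: "smooth_on (mdim N) (mdim P) (y ` V0) (chart_rep (V, y) (W, z) g)"
  using smooth_on_chart_rep[OF N_manifold P_manifold g_smooth V_chart W_chart] by (simp add: V0_def)

lemma chart_rep_compose:
  assumes "a \<in> x ` U0"
  shows "(chart_rep (V, y) (W, z) g \<circ> chart_rep (U, x) (V, y) f) a =
    chart_rep (U, x) (W, z) (compose (carrier M) g f) a"
proof -
  obtain p where p: "p \<in> U" "f p \<in> V" "a = x p"
    using assms by (auto simp: U0_def V0_def)
  moreover have "p \<in> carrier M" using p(1) atlas_chart(2)[OF M_manifold U_chart] by auto
  ultimately show ?thesis
    using inv_into_chart[OF M_manifold U_chart] inv_into_chart[OF N_manifold V_chart]
    by (simp add: chart_rep_def compose_def)
qed

lemma smooth_on_compose_chart_rep: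
  "smooth_on (mdim M) (mdim P) (x ` U0) (chart_rep (U, x) (W, z) (compose (carrier M) g f))"
  by (rule smooth_on_cong[OF openin_image_U0 chart_rep_compose
        smooth_on_compose[OF openin_image_U0 openin_image_V0 chart_rep_image smooth_on_g smooth_on_f]])

lemma differential_chart_rep_compose:
  assumes "p \<in> U" and "f p \<in> V" and "g (f p) \<in> W"
  shows "differential (mdim M) (mdim P) (chart_rep (U, x) (W, z) (compose (carrier M) g f)) (x p) v =
    differential (mdim N) (mdim P) (chart_rep (V, y) (W, z) g) (y (f p))
      (differential (mdim M) (mdim N) (chart_rep (U, x) (V, y) f) (x p) v)"
proof -
  have p: "x p \<in> x ` U0" using assms by (auto simp: U0_def V0_def)
  have "chart_rep (U, x) (V, y) f (x p) = y (f p)"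
    using assms(1) inv_into_chart[OF M_manifold U_chart] by (simp add: chart_rep_def)
  then show ?thesis
    using differential_compose[OF openin_image_U0 openin_image_V0 chart_rep_image
        smooth_on_g smooth_on_f p, of v]
      differential_cong[OF openin_image_U0 p chart_rep_compose, where m = "mdim P" and v = v]
    by simp
qed

end

lemma smooth_map_compose:
  assumes M: "smooth_manifold M" and N: "smooth_manifold N" and P: "smooth_manifold P"
    and f: "smooth_map M N f" and g: "smooth_map N P g"
  shows "smooth_map M P (compose (carrier M) g f)"
proof -
  have "\<exists>(U, x)\<in>atlas M. \<exists>(W, z)\<in>atlas P. p \<in> U \<and> compose (carrier M) g f ` U \<subseteq> W \<and>
      smooth_on (mdim M) (mdim P) (x ` U) (chart_rep (U, x) (W, z) (compose (carrier M) g f))"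
    if p: "p \<in> carrier M" for p
  proof -
    obtain U x where U: "(U, x) \<in> atlas M" "p \<in> U"
      using chart_covers[OF M p] .
    obtain V y where V: "(V, y) \<in> atlas N" "f p \<in> V"
      using chart_covers[OF N smooth_map_funcset[OF f p]] .
    obtain W z where W: "(W, z) \<in> atlas P" "g (f p) \<in> W"
      using chart_covers[OF P smooth_map_funcset[OF g smooth_map_funcset[OF f p]]] .
    interpret composable_charts M N P f g U x V y W z
      using assms U V W by unfold_locales
    have sub: "U0 \<subseteq> U" by (auto simp: U0_def)
    \<comment> \<open>\<open>U\<close> may be too large: the composite has to send the whole chart
      domain into \<open>W\<close>.\<close>
    have U0: "(U0, restrict x U0) \<in> atlas M"
      by (rule restrict_chart_in_atlas[OF M U(1) openin_U0 sub])
    have img: "restrict x U0 ` U0 = x ` U0" by auto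
    have "smooth_on (mdim M) (mdim P) (x ` U0)
        (chart_rep (U0, restrict x U0) (W, z) (compose (carrier M) g f))"
    proof (rule smooth_on_cong[OF openin_image_U0 _ smooth_on_compose_chart_rep])
      fix a assume "a \<in> x ` U0"
      then obtain q where q: "q \<in> U0" "a = x q" by blast
      then show "chart_rep (U, x) (W, z) (compose (carrier M) g f) a =
          chart_rep (U0, restrict x U0) (W, z) (compose (carrier M) g f) a"
        using inv_into_chart[OF M U(1), of q] inv_into_chart[OF M U0, of q] sub
        by (auto simp: chart_rep_def)
    qed
    moreover have "p \<in> U0" using U V W by (simp add: U0_def V0_def)
    moreover have "compose (carrier M) g f ` U0 \<subseteq> W"
      using atlas_chart(2)[OF M U0] by (auto simp: compose_def U0_def V0_def)
    ultimately show ?thesis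
      using U0 W(1) img by (intro bexI[OF _ U0] bexI[OF _ W(1)] case_prodI) auto
  qed
  moreover have "compose (carrier M) g f \<in> carrier M \<rightarrow>\<^sub>E carrier P"
    using smooth_map_funcset[OF f] smooth_map_funcset[OF g] by (auto simp: compose_def)
  ultimately show ?thesis by (simp add: smooth_map_def)
qed

lemma smooth_map_id:
  assumes M: "smooth_manifold M"
  shows "smooth_map M M (\<lambda>p\<in>carrier M. p)"
proof -
  have smooth: "smooth_on (mdim M) (mdim M) (x ` U) (chart_rep (U, x) (U, x) (\<lambda>p\<in>carrier M. p))"
    if U: "(U, x) \<in> atlas M" for U x
  proof (rule smooth_on_cong)
    show "openin (Euclidean_space (mdim M)) (x ` U)" by (rule atlas_chart(5)[OF M U])
    show "smooth_on (mdim M) (mdim M) (x ` U) (x \<circ> inv_into U x)"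
      using smooth_on_transition[OF M U U] by simp
    show "(x \<circ> inv_into U x) a = chart_rep (U, x) (U, x) (\<lambda>p\<in>carrier M. p) a" if "a \<in> x ` U" for a
      using that atlas_chart(2)[OF M U] inv_into_chart[OF M U] by (auto simp: chart_rep_def)
  qed
  have image: "(\<lambda>p\<in>carrier M. p) ` U \<subseteq> U" if "(U, x) \<in> atlas M" for U x
    using atlas_chart(2)[OF M that] by auto
  have *: "\<exists>(U, x)\<in>atlas M. \<exists>(V, y)\<in>atlas M. p \<in> U \<and> (\<lambda>p\<in>carrier M. p) ` U \<subseteq> V \<and>
      smooth_on (mdim M) (mdim M) (x ` U) (chart_rep (U, x) (V, y) (\<lambda>p\<in>carrier M. p))"
    if p: "p \<in> carrier M" for p
  proof -
    obtain U x where U: "(U, x) \<in> atlas M" "p \<in> U"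
      using chart_covers[OF M p] .
    show ?thesis
      using U(2) smooth[OF U(1)] image[OF U(1)]
      by (intro bexI[OF _ U(1)] case_prodI conjI)
  qed
  show ?thesis unfolding smooth_map_def
    by (intro conjI ballI *) auto
qed

section \<open>Submersions and composition\<close>

lemma submersionI:
  assumes "smooth_map M N f"
    and "\<And>p U x V y. p \<in> carrier M \<Longrightarrow> (U, x) \<in> atlas M \<Longrightarrow> p \<in> U \<Longrightarrow> (V, y) \<in> atlas N \<Longrightarrow> f p \<in> V \<Longrightarrow>
      differential (mdim M) (mdim N) (chart_rep (U, x) (V, y) f) (x p)
        ` topspace (Euclidean_space (mdim M)) = topspace (Euclidean_space (mdim N))"
  shows "submersion M N f"
  unfolding submersion_def using assms by (intro conjI ballI case_prodI2 impI) simp_all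

text \<open>The submersion condition is stated in all charts, so any chart around \<open>f p\<close>
  can serve as the intermediate one in the chain rule.\<close>

lemma submersion_compose:
  assumes M: "smooth_manifold M" and N: "smooth_manifold N" and P: "smooth_manifold P"
    and f: "submersion M N f" and g: "submersion N P g"
  shows "submersion M P (compose (carrier M) g f)"
proof (rule submersionI)
  have f': "smooth_map M N f" and g': "smooth_map N P g"
    using f g by (auto simp: submersion_def)
  then show "smooth_map M P (compose (carrier M) g f)"
    by (rule smooth_map_compose[OF M N P])
  fix p U x W z assume p: "p \<in> carrier M" and U: "(U, x) \<in> atlas M" "p \<in> U"
    and W: "(W, z) \<in> atlas P" "compose (carrier M) g f p \<in> W"
  obtain V y where V: "(V, y) \<in> atlas N" "f p \<in> V"
    using chart_covers[OF N smooth_map_funcset[OF f' p]] .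
  interpret composable_charts M N P f g U x V y W z
    using M N P f' g' U V W by unfold_locales
  have gW: "g (f p) \<in> W" using W(2) p by (simp add: compose_def)
  have "differential (mdim M) (mdim P) (chart_rep (U, x) (W, z) (compose (carrier M) g f)) (x p)
        ` topspace (Euclidean_space (mdim M)) =
      differential (mdim N) (mdim P) (chart_rep (V, y) (W, z) g) (y (f p))
        ` differential (mdim M) (mdim N) (chart_rep (U, x) (V, y) f) (x p)
        ` topspace (Euclidean_space (mdim M))"
    using differential_chart_rep_compose[OF U(2) V(2) gW] by (simp add: image_image)
  also have "differential (mdim M) (mdim N) (chart_rep (U, x) (V, y) f) (x p)
      ` topspace (Euclidean_space (mdim M)) = topspace (Euclidean_space (mdim N))"
    using f p U V unfolding submersion_def by fast
  also have "differential (mdim N) (mdim P) (chart_rep (V, y) (W, z) g) (y (f p))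
      ` topspace (Euclidean_space (mdim N)) = topspace (Euclidean_space (mdim P))"
    using g smooth_map_funcset[OF f' p] V W gW unfolding submersion_def by fast
  finally show "differential (mdim M) (mdim P) (chart_rep (U, x) (W, z) (compose (carrier M) g f)) (x p)
      ` topspace (Euclidean_space (mdim M)) = topspace (Euclidean_space (mdim P))" .
qed

text \<open>If a composite of maps is onto, so is the outer one. The chain rule gives this at points
  \<open>f p\<close>, and surjectivity of \<open>f\<close> makes every point of \<open>N\<close>
  such a point.\<close>

lemma submersion_cancel_right:
  assumes M: "smooth_manifold M" and N: "smooth_manifold N" and P: "smooth_manifold P"
    and f: "smooth_map M N f" "f ` carrier M = carrier N" and g: "smooth_map N P g"
    and gf: "submersion M P (compose (carrier M) g f)"
  shows "submersion N P g"
proof (rule submersionI[OF g])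
  fix q V y W z assume q: "q \<in> carrier N" and V: "(V, y) \<in> atlas N" "q \<in> V"
    and W: "(W, z) \<in> atlas P" "g q \<in> W"
  obtain p where p: "p \<in> carrier M" "q = f p" using f(2) q by blast
  obtain U x where U: "(U, x) \<in> atlas M" "p \<in> U"
    using chart_covers[OF M p(1)] .
  interpret composable_charts M N P f g U x V y W z
    using M N P f g U V W by unfold_locales
  let ?d = "differential (mdim N) (mdim P) (chart_rep (V, y) (W, z) g) (y q)"
  have "compose (carrier M) g f p \<in> W" using W(2) p by (simp add: compose_def)
  then have "differential (mdim M) (mdim P) (chart_rep (U, x) (W, z) (compose (carrier M) g f)) (x p)
      ` topspace (Euclidean_space (mdim M)) = topspace (Euclidean_space (mdim P))"
    using gf p(1) U W(1) unfolding submersion_def by fast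
  \<comment> \<open>The inclusion that carries content; the reverse one holds because
    \<open>differential\<close> is zero from the target dimension on.\<close>
  then have "topspace (Euclidean_space (mdim P)) \<subseteq> ?d ` topspace (Euclidean_space (mdim N))"
    using differential_chart_rep_compose[of p] U(2) V(2) W(2) p(2) differential_in_Euclidean_space
    by (auto simp: image_def set_eq_iff) metis
  then show "?d ` topspace (Euclidean_space (mdim N)) = topspace (Euclidean_space (mdim P))"
    using differential_in_Euclidean_space by blast
qed

section \<open>Categories of factorizations\<close>

lemma is_categoryD:
  assumes "is_category \<C>"
  shows "f \<in> arrs \<C> \<Longrightarrow> src \<C> f \<in> obs \<C>"
    and "f \<in> arrs \<C> \<Longrightarrow> tgt \<C> f \<in> obs \<C>"
    and "A \<in> obs \<C> \<Longrightarrow> ident \<C> A \<in> arrs \<C>"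
    and "A \<in> obs \<C> \<Longrightarrow> src \<C> (ident \<C> A) = A"
    and "A \<in> obs \<C> \<Longrightarrow> tgt \<C> (ident \<C> A) = A"
    and "f \<in> arrs \<C> \<Longrightarrow> g \<in> arrs \<C> \<Longrightarrow> tgt \<C> f = src \<C> g \<Longrightarrow> cmp \<C> g f \<in> arrs \<C>"
    and "f \<in> arrs \<C> \<Longrightarrow> g \<in> arrs \<C> \<Longrightarrow> tgt \<C> f = src \<C> g \<Longrightarrow> src \<C> (cmp \<C> g f) = src \<C> f"
    and "f \<in> arrs \<C> \<Longrightarrow> g \<in> arrs \<C> \<Longrightarrow> tgt \<C> f = src \<C> g \<Longrightarrow> tgt \<C> (cmp \<C> g f) = tgt \<C> g"
    and "f \<in> arrs \<C> \<Longrightarrow> cmp \<C> f (ident \<C> (src \<C> f)) = f"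
    and "f \<in> arrs \<C> \<Longrightarrow> cmp \<C> (ident \<C> (tgt \<C> f)) f = f"
    and "f \<in> arrs \<C> \<Longrightarrow> g \<in> arrs \<C> \<Longrightarrow> h \<in> arrs \<C> \<Longrightarrow> tgt \<C> f = src \<C> g \<Longrightarrow> tgt \<C> g = src \<C> h \<Longrightarrow>
      cmp \<C> h (cmp \<C> g f) = cmp \<C> (cmp \<C> h g) f"
  using assms unfolding is_category_def by blast+

text \<open>The inverse of a bijective functor is a functor: each law for \<open>Go\<close>,
  \<open>Ga\<close> is the corresponding law for \<open>Fo\<close>, \<open>Fa\<close> at the
  preimages, with the inverse then applied. So only one direction needs to be checked for
  functoriality.\<close>

lemma isomorphic_categoriesI:
  assumes F: "is_functor \<C> \<D> Fo Fa"
    and Go: "\<And>B. B \<in> obs \<D> \<Longrightarrow> Go B \<in> obs \<C>" and Ga: "\<And>g. g \<in> arrs \<D> \<Longrightarrow> Ga g \<in> arrs \<C>"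
    and GFo: "\<And>A. A \<in> obs \<C> \<Longrightarrow> Go (Fo A) = A" and GFa: "\<And>f. f \<in> arrs \<C> \<Longrightarrow> Ga (Fa f) = f"
    and FGo: "\<And>B. B \<in> obs \<D> \<Longrightarrow> Fo (Go B) = B" and FGa: "\<And>g. g \<in> arrs \<D> \<Longrightarrow> Fa (Ga g) = g"
  shows "isomorphic_categories \<C> \<D>"
proof -
  have C: "is_category \<C>" and D: "is_category \<D>"
    and F_ident: "\<And>A. A \<in> obs \<C> \<Longrightarrow> Fa (ident \<C> A) = ident \<D> (Fo A)"
    and F_src: "\<And>f. f \<in> arrs \<C> \<Longrightarrow> src \<D> (Fa f) = Fo (src \<C> f)"
    and F_tgt: "\<And>f. f \<in> arrs \<C> \<Longrightarrow> tgt \<D> (Fa f) = Fo (tgt \<C> f)"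
    and F_cmp: "\<And>f g. f \<in> arrs \<C> \<Longrightarrow> g \<in> arrs \<C> \<Longrightarrow> tgt \<C> f = src \<C> g \<Longrightarrow>
        Fa (cmp \<C> g f) = cmp \<D> (Fa g) (Fa f)"
    using F unfolding is_functor_def by blast+
  \<comment> \<open>\<open>Fo\<close> sends the source of \<open>Ga g\<close> to the source of
    \<open>g\<close>, and \<open>Go\<close> undoes \<open>Fo\<close>; likewise for targets.\<close>
  have G_src: "src \<C> (Ga g) = Go (src \<D> g)" and G_tgt: "tgt \<C> (Ga g) = Go (tgt \<D> g)"
    if "g \<in> arrs \<D>" for g
    using F_src[OF Ga[OF that]] F_tgt[OF Ga[OF that]] FGa[OF that] GFo
      is_categoryD(1,2)[OF C Ga[OF that]] by metis+
  have "is_functor \<D> \<C> Go Ga"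
    unfolding is_functor_def
  proof (intro conjI ballI impI)
    show "Ga (ident \<D> B) = ident \<C> (Go B)" if "B \<in> obs \<D>" for B
      using F_ident[OF Go[OF that]] FGo[OF that] GFa[OF is_categoryD(3)[OF C Go[OF that]]] by simp
    show "Ga (cmp \<D> g f) = cmp \<C> (Ga g) (Ga f)"
      if f: "f \<in> arrs \<D>" and g: "g \<in> arrs \<D>" and fg: "tgt \<D> f = src \<D> g" for f g
    proof -
      have *: "tgt \<C> (Ga f) = src \<C> (Ga g)" using G_src G_tgt f g fg by simp
      show ?thesis
        using F_cmp[OF Ga[OF f] Ga[OF g] *] FGa f g
          GFa[OF is_categoryD(6)[OF C Ga[OF f] Ga[OF g] *]] by simp
    qed
  qed (use C D Go Ga G_src G_tgt in auto)
  then show ?thesis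
    unfolding isomorphic_categories_def using assms by blast
qed

lemma is_functor_comp:
  assumes "is_functor \<C> \<D> Fo Fa" and "is_functor \<D> \<E> Go Ga"
  shows "is_functor \<C> \<E> (Go \<circ> Fo) (Ga \<circ> Fa)"
  using assms unfolding is_functor_def by simp

lemma isomorphic_categories_sym:
  "isomorphic_categories \<C> \<D> \<Longrightarrow> isomorphic_categories \<D> \<C>"
  unfolding isomorphic_categories_def by blast

lemma isomorphic_categories_trans:
  assumes "isomorphic_categories \<C> \<D>" and "isomorphic_categories \<D> \<E>"
  shows "isomorphic_categories \<C> \<E>"
proof -
  obtain Fo Fa Go Ga where F: "is_functor \<C> \<D> Fo Fa" "is_functor \<D> \<C> Go Ga"
    "\<forall>A\<in>obs \<C>. Go (Fo A) = A" "\<forall>f\<in>arrs \<C>. Ga (Fa f) = f"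
    "\<forall>B\<in>obs \<D>. Fo (Go B) = B" "\<forall>g\<in>arrs \<D>. Fa (Ga g) = g"
    using assms(1) unfolding isomorphic_categories_def by blast
  obtain Fo' Fa' Go' Ga' where F': "is_functor \<D> \<E> Fo' Fa'" "is_functor \<E> \<D> Go' Ga'"
    "\<forall>A\<in>obs \<D>. Go' (Fo' A) = A" "\<forall>f\<in>arrs \<D>. Ga' (Fa' f) = f"
    "\<forall>B\<in>obs \<E>. Fo' (Go' B) = B" "\<forall>g\<in>arrs \<E>. Fa' (Ga' g) = g"
    using assms(2) unfolding isomorphic_categories_def by blast
  show ?thesis
    using F(3-) F'(3-) F(1,2) F'(1,2)
    by (intro isomorphic_categoriesI[OF is_functor_comp[OF F(1) F'(1)], of "Go \<circ> Go'" "Ga \<circ> Ga'"])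
      (auto simp: is_functor_def)
qed

section \<open>Coslice categories\<close>

lemma mem_obs_coslice:
  "(B, f) \<in> obs (coslice A \<C>) \<longleftrightarrow> B \<in> obs \<C> \<and> f \<in> arrs \<C> \<and> src \<C> f = A \<and> tgt \<C> f = B"
  by (simp add: coslice_def)

lemma mem_arrs_coslice:
  "(X, h, Y) \<in> arrs (coslice A \<C>) \<longleftrightarrow> X \<in> obs (coslice A \<C>) \<and> Y \<in> obs (coslice A \<C>) \<and>
     h \<in> arrs \<C> \<and> src \<C> h = fst X \<and> tgt \<C> h = fst Y \<and> cmp \<C> h (snd X) = snd Y"
  by (cases X; cases Y) (auto simp: coslice_def)

lemma coslice_simps:
  "src (coslice A \<C>) (X, h, Y) = X"
  "tgt (coslice A \<C>) (X, h, Y) = Y"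
  "ident (coslice A \<C>) X = (X, ident \<C> (fst X), X)"
  "cmp (coslice A \<C>) (Y', k, Z) (X, h, Y) = (X, cmp \<C> k h, Z)"
  by (simp_all add: coslice_def)

lemma is_category_coslice:
  assumes C: "is_category \<C>"
  shows "is_category (coslice A \<C>)"
  unfolding is_category_def
  by (auto simp: coslice_simps mem_arrs_coslice mem_obs_coslice is_categoryD[OF C]
      simp flip: is_categoryD(11)[OF C]) (metis is_categoryD(9)[OF C])+

section \<open>The category of quasiperiodic factorizations\<close>

lemma mem_obs_QuasiP: "F \<in> obs (QuasiP M N u) \<longleftrightarrow> quasiperiodic_factorization M N u F"
  by (simp add: QuasiP_def)

lemma mem_arrs_QuasiP:
  "((C1, \<phi>1, U1), c, (C2, \<phi>2, U2)) \<in> arrs (QuasiP M N u) \<longleftrightarrow>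
     quasiperiodic_factorization M N u (C1, \<phi>1, U1) \<and>
     quasiperiodic_factorization M N u (C2, \<phi>2, U2) \<and>
     smooth_map C1 C2 c \<and> \<phi>2 = compose (carrier M) c \<phi>1 \<and> U1 = compose (carrier C1) U2 c"
  by (auto simp: QuasiP_def)

lemma QuasiP_simps:
  "src (QuasiP M N u) (X, c, Y) = X"
  "tgt (QuasiP M N u) (X, c, Y) = Y"
  "ident (QuasiP M N u) X = (X, (\<lambda>p\<in>carrier (fst X). p), X)"
  "cmp (QuasiP M N u) (Y', d, Z) (X, c, Y) = (X, compose (carrier (fst X)) d c, Z)"
  by (simp_all add: QuasiP_def)

lemma quasiperiodic_factorizationD:
  assumes "quasiperiodic_factorization M N u (C, \<phi>, U)"
  shows "smooth_manifold C" and "submersion M C \<phi>" and "smooth_map M C \<phi>"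
    and "\<phi> ` carrier M = carrier C" and "smooth_map C N U" and "u = compose (carrier M) U \<phi>"
  using assms by (auto simp: quasiperiodic_factorization_def submersion_def)

lemma smooth_map_Pi: "smooth_map M N f \<Longrightarrow> f \<in> carrier M \<rightarrow> carrier N"
  by (auto simp: smooth_map_def)

lemma smooth_map_extensional: "smooth_map M N f \<Longrightarrow> f \<in> extensional (carrier M)"
  by (auto simp: smooth_map_def PiE_def)

text \<open>\<open>compose\<close> yields \<open>undefined\<close> off the given set, so
  associativity depends on \<open>f\<close> mapping into \<open>carrier N\<close>, where the inner
  composite is not cut off.\<close>

lemma compose_smooth_assoc:
  "smooth_map M N f \<Longrightarrow>
     compose (carrier M) (compose (carrier N) h g) f = compose (carrier M) h (compose (carrier M) g f)"
  by (rule compose_assoc[OF smooth_map_Pi, symmetric])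

lemma compose_smooth_id:
  assumes "smooth_map M N f"
  shows "compose (carrier M) (\<lambda>q\<in>carrier N. q) f = f"
    and "compose (carrier M) f (\<lambda>p\<in>carrier M. p) = f"
  using smooth_map_Pi[OF assms] smooth_map_extensional[OF assms]
  by (simp_all add: Id_compose compose_Id)

lemma is_category_QuasiP: "is_category (QuasiP M N u)"
  unfolding is_category_def
proof (intro conjI ballI impI)
  fix f assume f: "f \<in> arrs (QuasiP M N u)"
  obtain C1 \<phi>1 U1 c C2 \<phi>2 U2 where feq: "f = ((C1, \<phi>1, U1), c, (C2, \<phi>2, U2))"
    by (metis prod.exhaust)
  note f = f[unfolded feq mem_arrs_QuasiP]
  from f have q1: "quasiperiodic_factorization M N u (C1, \<phi>1, U1)"
    and q2: "quasiperiodic_factorization M N u (C2, \<phi>2, U2)" and c: "smooth_map C1 C2 c" by blast+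
  note qf1 = quasiperiodic_factorizationD[OF q1] and qf2 = quasiperiodic_factorizationD[OF q2]
  show "src (QuasiP M N u) f \<in> obs (QuasiP M N u)" "tgt (QuasiP M N u) f \<in> obs (QuasiP M N u)"
    "cmp (QuasiP M N u) f (ident (QuasiP M N u) (src (QuasiP M N u) f)) = f"
    "cmp (QuasiP M N u) (ident (QuasiP M N u) (tgt (QuasiP M N u) f)) f = f"
    using q1 q2 compose_smooth_id[OF c] by (simp_all add: feq QuasiP_simps mem_obs_QuasiP)
  fix g assume g: "g \<in> arrs (QuasiP M N u)" and fg: "tgt (QuasiP M N u) f = src (QuasiP M N u) g"
  obtain d C3 \<phi>3 U3 where geq: "g = ((C2, \<phi>2, U2), d, (C3, \<phi>3, U3))"
    using fg by (metis prod.exhaust QuasiP_simps(1,2) feq)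
  note g = g[unfolded geq mem_arrs_QuasiP]
  from g have q3: "quasiperiodic_factorization M N u (C3, \<phi>3, U3)" by blast
  note qf3 = quasiperiodic_factorizationD[OF q3]
  have "smooth_map C1 C3 (compose (carrier C1) d c)"
    using f g by (blast intro: smooth_map_compose[OF qf1(1) qf2(1) qf3(1)])
  moreover have "\<phi>3 = compose (carrier M) (compose (carrier C1) d c) \<phi>1"
    using f g compose_smooth_assoc[OF qf1(3), of d c] by metis
  moreover have "U1 = compose (carrier C1) U3 (compose (carrier C1) d c)"
    using f g compose_smooth_assoc[of C1 C2 c U3 d] by metis
  ultimately show "cmp (QuasiP M N u) g f \<in> arrs (QuasiP M N u)"
    using q1 q3 unfolding feq geq QuasiP_simps mem_arrs_QuasiP fst_conv by blast
  show "src (QuasiP M N u) (cmp (QuasiP M N u) g f) = src (QuasiP M N u) f"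
    "tgt (QuasiP M N u) (cmp (QuasiP M N u) g f) = tgt (QuasiP M N u) g"
    by (simp_all add: feq geq QuasiP_simps)
  fix h assume h: "h \<in> arrs (QuasiP M N u)" and gh: "tgt (QuasiP M N u) g = src (QuasiP M N u) h"
  obtain e F where heq: "h = ((C3, \<phi>3, U3), e, F)"
    using gh by (metis prod.exhaust QuasiP_simps(1,2) geq)
  show "cmp (QuasiP M N u) h (cmp (QuasiP M N u) g f) = cmp (QuasiP M N u) (cmp (QuasiP M N u) h g) f"
    using f by (simp add: feq geq heq QuasiP_simps compose_smooth_assoc)
next
  fix F assume "F \<in> obs (QuasiP M N u)"
  then show "ident (QuasiP M N u) F \<in> arrs (QuasiP M N u)"
    "src (QuasiP M N u) (ident (QuasiP M N u) F) = F"
    "tgt (QuasiP M N u) (ident (QuasiP M N u) F) = F"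
    by (cases F; auto simp: QuasiP_simps mem_arrs_QuasiP mem_obs_QuasiP smooth_map_id
        compose_smooth_id dest: quasiperiodic_factorizationD)+
qed

section \<open>Factorizations of \<open>U\<close> and the coslice category\<close>

text \<open>This is where submersivity enters: it passes between \<open>c\<close> and its composite with the surjective
  submersion \<open>\<phi>\<close>, so the right-hand side does not mention \<open>M\<close> and \<open>u\<close>.\<close>

lemma quasiperiodic_factorization_push_iff:
  assumes M: "smooth_manifold M" and A: "quasiperiodic_factorization M N u (C, \<phi>, U)"
    and c: "smooth_map C C' c" and U: "U = compose (carrier C) U' c"
  shows "quasiperiodic_factorization M N u (C', compose (carrier M) c \<phi>, U') \<longleftrightarrow>
    quasiperiodic_factorization C N U (C', c, U')"
proof -
  note A = quasiperiodic_factorizationD[OF A]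
  have "u = compose (carrier M) U' (compose (carrier M) c \<phi>)"
    using A(6) U compose_smooth_assoc[OF A(3)] by simp
  moreover have "compose (carrier M) c \<phi> ` carrier M = c ` carrier C"
    by (auto simp: compose_def simp flip: A(4))
  \<comment> \<open>\<open>smooth_manifold C'\<close> is a conjunct on both sides of the claim, so
    it may be assumed here.\<close>
  moreover have "submersion M C' (compose (carrier M) c \<phi>) \<longleftrightarrow> submersion C C' c"
    if "smooth_manifold C'"
    using submersion_compose[OF M A(1) that A(2)]
      submersion_cancel_right[OF M A(1) that A(3,4) c] by blast
  ultimately show ?thesis
    using U by (auto simp: quasiperiodic_factorization_def)
qed

text \<open>An object under \<open>(C, \<phi>, U)\<close> is a factorization
  \<open>(C', \<phi>', U')\<close> with a map \<open>c\<close> such that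
  \<open>\<phi>' = c \<circ> \<phi>\<close>; what remains free is \<open>(C', c, U')\<close>. Arrows
  keep their underlying map. As the points of \<open>C\<close> lie in \<open>'c\<close> too,
  factorizations of \<open>U\<close> use the same universe of phase spaces.\<close>

theorem coslice_QuasiP_isomorphic:
  fixes M :: "'m manifold" and N :: "'n manifold" and C :: "'c manifold"
  assumes M: "smooth_manifold M" and A: "quasiperiodic_factorization M N u (C, \<phi>, U)"
  shows "isomorphic_categories (coslice (C, \<phi>, U) (QuasiP M N u))
    (QuasiP C N U :: (('c, 'c, 'n) factorization, _) category)"
proof -
  let ?\<C> = "coslice (C, \<phi>, U) (QuasiP M N u)"
    and ?\<D> = "QuasiP C N U :: (('c, 'c, 'n) factorization, _) category"
  note AD = quasiperiodic_factorizationD[OF A]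
  \<comment> \<open>\<open>B\<close> precomposes with \<open>\<phi>\<close>, turning a factorization
    of \<open>U\<close> into one of \<open>u\<close>. \<open>Go\<close> attaches the structure arrow
    that makes the result an object of the coslice category, and \<open>Fo\<close> forgets all that
    can be rebuilt.\<close>
  define B :: "('c, 'c, 'n) factorization \<Rightarrow> ('m, 'c, 'n) factorization"
    where "B = (\<lambda>(C', c, U'). (C', compose (carrier M) c \<phi>, U'))"
  define Go where "Go F = (B F, (C, \<phi>, U), fst (snd F), B F)" for F
  define Ga where "Ga = (\<lambda>(F, h :: 'c \<Rightarrow> 'c, G). (Go F, (B F, h, B G), Go G))"
  define Fo :: "('m, 'c, 'n) factorization \<times> ('m, 'c, 'n) factorization \<times> ('c \<Rightarrow> 'c) \<times>
      ('m, 'c, 'n) factorization \<Rightarrow> ('c, 'c, 'n) factorization"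
    where "Fo = (\<lambda>((C', \<phi>', U'), A', c, B'). (C', c, U'))"
  define Fa where "Fa = (\<lambda>(X, (B1 :: ('m, 'c, 'n) factorization, h :: 'c \<Rightarrow> 'c,
      B2 :: ('m, 'c, 'n) factorization), Y). (Fo X, h, Fo Y))"
  \<comment> \<open>On the left, smoothness of \<open>c\<close> and the triangle for
    \<open>U\<close> come from the arrow out of \<open>(C, \<phi>, U)\<close>; on the right they are
    already part of being a factorization of \<open>U\<close>.\<close>
  have push_iff: "quasiperiodic_factorization M N u (C', compose (carrier M) c \<phi>, U') \<and>
        smooth_map C C' c \<and> U = compose (carrier C) U' c \<longleftrightarrow>
      quasiperiodic_factorization C N U (C', c, U')" for C' c U'
    using quasiperiodic_factorization_push_iff[OF M A, of C' c U']
      quasiperiodic_factorizationD[of C N U C' c U'] by blast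
  have Go_obs: "Go F \<in> obs ?\<C>" if "F \<in> obs ?\<D>" for F
    using that push_iff[of "fst F" "fst (snd F)" "snd (snd F)"] A
    by (cases F) (auto simp: Go_def B_def mem_obs_coslice mem_obs_QuasiP mem_arrs_QuasiP QuasiP_simps)
  have Fo_obs: "Fo X \<in> obs ?\<D> \<and> Go (Fo X) = X" if X: "X \<in> obs ?\<C>" for X
  proof -
    obtain B' c C' \<phi>' U' where Xeq: "X = (B', (C, \<phi>, U), c, (C', \<phi>', U'))"
      using X by (cases X) (auto simp: mem_obs_coslice QuasiP_simps)
    then have "B' = (C', \<phi>', U')" "quasiperiodic_factorization M N u (C', \<phi>', U')"
      "smooth_map C C' c" "\<phi>' = compose (carrier M) c \<phi>" "U = compose (carrier C) U' c"
      using X[unfolded Xeq mem_obs_coslice mem_arrs_QuasiP QuasiP_simps] by blast+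
    then show ?thesis
      using push_iff[of C' c U'] by (simp add: Xeq Fo_def Go_def B_def mem_obs_QuasiP)
  qed
  have Fo_Go: "Fo (Go F) = F" for F
    by (cases F) (simp add: Fo_def Go_def B_def)
  text \<open>An arrow of \<open>QuasiP M N u\<close> must also commute with the projections from \<open>M\<close>; this follows from
    the triangle under \<open>C\<close>.\<close>
  have Ga_arrs_iff: "Ga (F, h, G) \<in> arrs ?\<C> \<longleftrightarrow> (F, h, G) \<in> arrs ?\<D>"
    if FG: "F \<in> obs ?\<D>" "G \<in> obs ?\<D>" for F h G
  proof -
    obtain C1 c1 U1 C2 c2 U2 where eqs: "F = (C1, c1, U1)" "G = (C2, c2, U2)"
      by (metis prod.exhaust)
    have qf: "quasiperiodic_factorization C N U (C1, c1, U1)"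
      "quasiperiodic_factorization C N U (C2, c2, U2)"
      using FG by (simp_all add: eqs mem_obs_QuasiP)
    show ?thesis
      using Go_obs[OF FG(1)] Go_obs[OF FG(2)] qf push_iff[of C1 c1 U1] push_iff[of C2 c2 U2]
        compose_smooth_assoc[OF AD(3)]
      by (auto simp: Ga_def mem_arrs_coslice mem_arrs_QuasiP QuasiP_simps)
         (auto simp: eqs Go_def B_def mem_arrs_QuasiP QuasiP_simps)
  qed
  \<comment> \<open>Since \<open>Fa\<close> cancels \<open>Ga\<close>, the functor laws for
    \<open>Fa\<close> reduce to arrows in the explicit form \<open>Ga (F, h, G)\<close>.\<close>
  have arrs_C: "\<exists>F h G. F \<in> obs ?\<D> \<and> G \<in> obs ?\<D> \<and> f = Ga (F, h, G)"
    if f: "f \<in> arrs ?\<C>" for f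
  proof -
    obtain X B1 h B2 Y where feq: "f = (X, (B1, h, B2), Y)"
      by (metis prod.exhaust)
    then have XY: "X \<in> obs ?\<C>" "Y \<in> obs ?\<C>" "B1 = fst X" "B2 = fst Y"
      using f by (simp_all add: mem_arrs_coslice QuasiP_simps)
    then have "f = Ga (Fo X, h, Fo Y)"
      using Fo_obs[OF XY(1)] Fo_obs[OF XY(2)] by (simp add: feq Ga_def) (metis Go_def fst_conv)
    then show ?thesis using Fo_obs XY by blast
  qed
  have Fa_Ga: "Fa (Ga g) = g" for g
    by (cases g) (simp add: Fa_def Ga_def Fo_Go)
  show ?thesis
  proof (rule isomorphic_categoriesI[where Fo = Fo and Fa = Fa and Go = Go and Ga = Ga])
    show "Ga g \<in> arrs ?\<C>" if "g \<in> arrs ?\<D>" for g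
      using that Ga_arrs_iff by (cases g) (auto simp: mem_arrs_QuasiP mem_obs_QuasiP)
    show "Ga (Fa f) = f" if "f \<in> arrs ?\<C>" for f
      using arrs_C[OF that] Fa_Ga by auto
    show "is_functor ?\<C> ?\<D> Fo Fa"
      unfolding is_functor_def
    proof (intro conjI ballI impI)
      show "Fa (ident ?\<C> X) = ident ?\<D> (Fo X)" if "X \<in> obs ?\<C>" for X
        by (cases X) (simp add: coslice_simps QuasiP_simps Fa_def Fo_def split: prod.splits)
      show "Fa f \<in> arrs ?\<D>" "src ?\<D> (Fa f) = Fo (src ?\<C> f)" "tgt ?\<D> (Fa f) = Fo (tgt ?\<C> f)"
        if f: "f \<in> arrs ?\<C>" for f
      proof -
        obtain F h G where F: "F \<in> obs ?\<D>" "G \<in> obs ?\<D>" "f = Ga (F, h, G)"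
          using arrs_C[OF f] by blast
        then show "Fa f \<in> arrs ?\<D>" using Ga_arrs_iff f Fa_Ga by metis
        show "src ?\<D> (Fa f) = Fo (src ?\<C> f)" "tgt ?\<D> (Fa f) = Fo (tgt ?\<C> f)"
          by (simp_all add: F(3) Fa_Ga QuasiP_simps) (simp_all add: Ga_def coslice_simps Fo_Go)
      qed
      show "Fa (cmp ?\<C> g f) = cmp ?\<D> (Fa g) (Fa f)"
        if "f \<in> arrs ?\<C>" "g \<in> arrs ?\<C>" for f g
      proof -
        obtain F h G where "f = Ga (F, h, G)"
          using arrs_C[OF \<open>f \<in> _\<close>] by blast
        moreover obtain F' h' G' where "g = Ga (F', h', G')"
          using arrs_C[OF \<open>g \<in> _\<close>] by blast
        \<comment> \<open>Both compositions restrict to the carrier of the source phase space; these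
          carriers coincide because \<open>B\<close> does not change the phase space.\<close>
        moreover have "fst (B F) = fst F" for F by (cases F) (simp add: B_def)
        ultimately show ?thesis
          by (simp add: Fa_Ga QuasiP_simps)
            (simp add: Ga_def coslice_simps QuasiP_simps Fa_def Fo_Go)
      qed
    qed (simp_all add: Fo_obs is_category_QuasiP is_category_coslice)
  qed (simp_all add: Go_obs Fo_obs Fo_Go Fa_Ga)
qed

theorem theorem3:
  fixes M1 :: "'a manifold" and M2 :: "'b manifold" and N :: "'n manifold" and C :: "'c manifold"
    and u1 :: "'a \<Rightarrow> 'n" and u2 :: "'b \<Rightarrow> 'n"
    and \<phi>1 :: "'a \<Rightarrow> 'c" and \<phi>2 :: "'b \<Rightarrow> 'c" and U :: "'c \<Rightarrow> 'n"
  assumes "smooth_manifold M1" and "smooth_manifold M2" and "smooth_manifold N"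
    and "smooth_map M1 N u1" and "smooth_map M2 N u2"
    and "quasiperiodic_factorization M1 N u1 (C, \<phi>1, U)"
    and "quasiperiodic_factorization M2 N u2 (C, \<phi>2, U)"
  shows "isomorphic_categories (coslice (C, \<phi>1, U) (QuasiP M1 N u1))
                               (coslice (C, \<phi>2, U) (QuasiP M2 N u2))"
  using coslice_QuasiP_isomorphic[OF assms(1,6)] coslice_QuasiP_isomorphic[OF assms(2,7)]
  by (blast intro: isomorphic_categories_trans isomorphic_categories_sym)

end
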